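(* Let $\mu,\nu\in\mathcal P(\mathbb R)$ with $\mu\le_{\rm cx}\nu$ and $\nu$ atomless. For any strictly convex functions $f,g:\mathbb R\to\mathbb R$, $$\mathcal M_M(\mu,\nu)=\operatorname*{arg\,min}_{(X,Y)\in\Pi(\mu,\nu)}\mathbb E\big[f(\mathbb E[Y|X]-X)-g(\mathbb E[X|Y])\big].$$
   Context: $\mathcal P(\mathbb R)$ is the set of Borel probability measures on $\mathbb R$ with finite first moment. $\mu\le_{\rm cx}\nu$ (convex order) means $\int\phi\,d\mu\le\int\phi\,d\nu$ for every convex $\phi:\mathbb R\to\mathbb R$. $\Pi(\mu,\nu)$ is the set of couplings of $\mu$ and $\nu$, i.e. joint laws of random vectors $(X,Y)$ with $X\sim\mu$ and $Y\sim\nu$; by abuse of notation one writes $(X,Y)\in\Pi(\mu,\nu)$ when the law of $(X,Y)$ belongs to $\Pi(\mu,\nu)$, and likewise for its subsets. $\mathcal M_M(\mu,\nu)$ is the set of (backward) Monge martingale transports, i.e. those $\pi\in\Pi(\mu,\nu)$ that are laws of $(X,Y)$ with $\mathbb E[Y|X]=X$ a.s. and $X=h(Y)$ a.s. for some measurable function $h:\mathbb R\to\mathbb R$.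
   Formalization: The formal theorem also assumes that g is μ-integrable, i.e. E[g(X)] is finite; if E[g(X)] is infinite, the minimum is −∞ and is also attained by couplings that are not Monge martingale transports, so the claim fails. *)

theory Defs
  imports "HOL-Probability.Probability"
begin

definition prob_finite_mean :: "real measure set" where
  "prob_finite_mean =
    {\<mu>. prob_space \<mu> \<and> sets \<mu> = sets borel \<and> integrable \<mu> (\<lambda>x. x)}"

(* The Bochner integral is 0 on non-integrable functions, so expectations that may be infinite
   are taken in the extended reals.  This is the usual value as soon as the positive or the
   negative part of f is integrable; if both parts have infinite integral the value is junk. *)
definition ext_expectation :: "'a measure \<Rightarrow> ('a \<Rightarrow> real) \<Rightarrow> ereal" where
  "ext_expectation M f =
    enn2ereal (\<integral>\<^sup>+ \<omega>. ennreal (f \<omega>) \<partial>M) - enn2ereal (\<integral>\<^sup>+ \<omega>. ennreal (- f \<omega>) \<partial>M)"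

(* For measures with finite mean the negative part of a convex function is integrable, because
   the function has an affine minorant. *)
definition convex_order :: "real measure \<Rightarrow> real measure \<Rightarrow> bool"  (infix "\<le>cx" 50) where
  "\<mu> \<le>cx \<nu> \<longleftrightarrow>
    (\<forall>\<phi> :: real \<Rightarrow> real. convex_on UNIV \<phi> \<longrightarrow> ext_expectation \<mu> \<phi> \<le> ext_expectation \<nu> \<phi>)"

definition atomless :: "real measure \<Rightarrow> bool" where
  "atomless \<nu> \<longleftrightarrow> (\<forall>x. emeasure \<nu> {x} = 0)"

definition strictly_convex :: "(real \<Rightarrow> real) \<Rightarrow> bool" where
  "strictly_convex f \<longleftrightarrow>
    (\<forall>x y t. x \<noteq> y \<longrightarrow> 0 < t \<longrightarrow> t < 1 \<longrightarrow>
      f ((1 - t) * x + t * y) < (1 - t) * f x + t * f y)"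

(* A coupling is a joint law on the plane; the random vector (X, Y) with this law is realised
   canonically as the pair of coordinate projections (fst, snd). *)
definition couplings :: "real measure \<Rightarrow> real measure \<Rightarrow> (real \<times> real) measure set" where
  "couplings \<mu> \<nu> =
    {\<pi>. prob_space \<pi> \<and> sets \<pi> = sets (borel \<Otimes>\<^sub>M borel)
      \<and> distr \<pi> borel fst = \<mu> \<and> distr \<pi> borel snd = \<nu>}"

(* cond_expectation M Z W is E[Z | W]. *)
definition cond_expectation ::
    "'a measure \<Rightarrow> ('a \<Rightarrow> real) \<Rightarrow> ('a \<Rightarrow> real) \<Rightarrow> 'a \<Rightarrow> real" where
  "cond_expectation M Z W = real_cond_exp M (vimage_algebra (space M) W borel) Z"

definition monge_martingale_transports ::
    "real measure \<Rightarrow> real measure \<Rightarrow> (real \<times> real) measure set" where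
  "monge_martingale_transports \<mu> \<nu> =
    {\<pi> \<in> couplings \<mu> \<nu>.
      (AE \<omega> in \<pi>. cond_expectation \<pi> snd fst \<omega> = fst \<omega>) \<and>
      (\<exists>h \<in> borel_measurable borel. AE \<omega> in \<pi>. fst \<omega> = h (snd \<omega>))}"

(* With f, g convex and g integrable with respect to the law of X, the negative part of the
   integrand is integrable, so the objective is a genuine expectation in (-\<infinity>, \<infinity>]. *)
definition transport_objective ::
    "(real \<Rightarrow> real) \<Rightarrow> (real \<Rightarrow> real) \<Rightarrow> (real \<times> real) measure \<Rightarrow> ereal" where
  "transport_objective f g \<pi> =
    ext_expectation \<pi> (\<lambda>\<omega>. f (cond_expectation \<pi> snd fst \<omega> - fst \<omega>)
                          - g (cond_expectation \<pi> fst snd \<omega>))"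

(* is_arg_min yields one minimiser at a time; this is the set of all of them. *)
definition arg_min_set :: "('a \<Rightarrow> ereal) \<Rightarrow> 'a set \<Rightarrow> 'a set" where
  "arg_min_set F A = {x. is_arg_min F (\<lambda>x. x \<in> A) x}"

end

theory Submission
  imports Defs
begin

text \<open>Write \<open>V = E[Y|X] - X\<close>, which has mean zero because \<open>\<mu>\<close> and \<open>\<nu>\<close> have the same mean. By Jensen's
  inequality the objective is at least \<open>f 0 - \<integral> g \<partial>\<mu>\<close>, and by strict convexity equality holds iff
  \<open>V = 0\<close> and \<open>E[X|Y] = X\<close> almost surely, that is, iff the coupling is a backward Monge martingale
  transport. It remains to see that such a transport exists.

  Given a cut point \<open>a\<close>, an atomless \<open>\<nu>\<close> dominating \<open>\<mu>\<close> in convex order can be split along a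
  Borel set \<open>B\<close> such that \<open>\<nu>\<close> restricted to \<open>B\<close> dominates \<open>\<mu>\<close> restricted to \<open>{..a}\<close>, and
  the complementary restrictions are in convex order as well. Iterating over an enumeration of the rationals
  gives Borel sets \<open>B\<^sub>q\<close>, increasing in \<open>q\<close> up to null sets, with \<open>\<nu> B\<^sub>q = \<mu> {..q}\<close> and
  \<open>\<integral>\<^bsub>B\<^sub>q\<^esub> y \<partial>\<nu> = \<integral>\<^bsub>{..q}\<^esub> x \<partial>\<mu>\<close>; then \<open>X = h(Y)\<close> with \<open>h y = Inf {q. y \<in> B\<^sub>q}\<close>.\<close>

section \<open>Finite measures on the line and their call functions\<close>

locale finite_mean_measure = finite_borel_measure +
  assumes integrable_id: "integrable M (\<lambda>x. x)"

definition partial_mean :: "real measure \<Rightarrow> real set \<Rightarrow> real" where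
  "partial_mean M A = (\<integral>x. indicator A x * x \<partial>M)"

text \<open>The call function \<open>k \<mapsto> \<integral> (x - k)\<^sup>+ \<partial>M\<close> of the restriction to a set:
  for measures of equal mass and mean, the convex order is the pointwise order of call functions.\<close>

definition call :: "real measure \<Rightarrow> real set \<Rightarrow> real \<Rightarrow> real" where
  "call M A k = (\<integral>x. indicator A x * max 0 (x - k) \<partial>M)"

text \<open>The common mass need not be 1, so the relation can be handed on to both halves of a
  split without renormalising.\<close>

definition cx_on :: "real measure \<Rightarrow> real set \<Rightarrow> real measure \<Rightarrow> real set \<Rightarrow> bool" where
  "cx_on M I N A \<longleftrightarrow> measure M I = measure N A \<and> partial_mean M I = partial_mean N A
     \<and> (\<forall>k. call M I k \<le> call N A k)"

text \<open>A density rather than a subspace: the underlying space stays the whole line, so a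
  restriction is again an instance of \<open>finite_mean_measure\<close>.\<close>

definition restr :: "real measure \<Rightarrow> real set \<Rightarrow> real measure" where
  "restr M A = density M (indicator A)"

text \<open>This is convexity in the strike \<open>k\<close>, multiplied by \<open>v - u\<close> so
  that \<open>u = v\<close> is allowed.\<close>

lemma max_0_diff_convex_comb:
  fixes u v k x :: real
  assumes "u \<le> k" "k \<le> v"
  shows "(v - u) * max 0 (x - k) \<le> (v - k) * max 0 (x - u) + (k - u) * max 0 (x - v)"
proof -
  consider "x \<le> k" | "k < x" "x \<le> v" | "v < x" by linarith
  then show ?thesis
  proof cases
    case 1 then show ?thesis using assms by simp
  next
    case 2
    have "(v - u) * (x - k) \<le> (v - k) * (x - u)"
    proof -
      have "(v - k) * (x - u) - (v - u) * (x - k) = (k - u) * (v - x)" by (simp add: algebra_simps)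
      then show ?thesis using 2 assms by (smt (verit) mult_nonneg_nonneg)
    qed
    then show ?thesis using 2 assms by (simp add: max_def)
  next
    case 3 then show ?thesis using assms by (simp add: max_def) (simp add: algebra_simps)
  qed
qed

context finite_mean_measure
begin

lemma measurable_M [measurable_cong]: "sets M = sets borel"
  by (rule M_is_borel)

lemma space_M [simp]: "space M = UNIV"
  by (rule borel_UNIV)

lemma measurable_borel_M [simp]: "f \<in> borel_measurable M \<longleftrightarrow> f \<in> borel_measurable borel"
  by (simp add: measurable_cong_sets[OF M_is_borel refl])

lemma integrable_indicator_mult:
  fixes f :: "real \<Rightarrow> real"
  assumes "A \<in> sets borel" "integrable M f"
  shows "integrable M (\<lambda>x. indicator A x * f x)"
  using integrable_mult_indicator[of A M f] assms by (simp add: M_is_borel)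

lemma integrable_ind [simp]: "A \<in> sets borel \<Longrightarrow> integrable M (indicat_real A)"
  by (simp add: M_is_borel emeasure_eq_measure less_top[symmetric])

lemma integrable_ind_mult_id [simp]:
  "A \<in> sets borel \<Longrightarrow> integrable M (\<lambda>x. indicator A x * x)"
  by (rule integrable_indicator_mult[OF _ integrable_id])

lemma integrable_call [simp]: "integrable M (\<lambda>x. max 0 (x - k))"
  by (intro integrable_max Bochner_Integration.integrable_diff integrable_id) simp_all

lemma integrable_ind_mult_call [simp]:
  "A \<in> sets borel \<Longrightarrow> integrable M (\<lambda>x. indicator A x * max 0 (x - k))"
  by (rule integrable_indicator_mult) simp_all

lemma call_nonneg: "0 \<le> call M A k"
  unfolding call_def by (intro Bochner_Integration.integral_nonneg) simp

lemma partial_mean_Un: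
  assumes "A \<in> sets borel" "B \<in> sets borel" "A \<inter> B = {}"
  shows "partial_mean M (A \<union> B) = partial_mean M A + partial_mean M B"
proof -
  have "partial_mean M (A \<union> B) = (\<integral>x. indicator A x * x + indicator B x * x \<partial>M)"
    unfolding partial_mean_def
    by (intro Bochner_Integration.integral_cong) (use assms in \<open>auto split: split_indicator\<close>)
  then show ?thesis using assms by (simp add: partial_mean_def)
qed

lemma call_Un:
  assumes "A \<in> sets borel" "B \<in> sets borel" "A \<inter> B = {}"
  shows "call M (A \<union> B) k = call M A k + call M B k"
proof -
  have "call M (A \<union> B) k = (\<integral>x. indicator A x * max 0 (x - k) + indicator B x * max 0 (x - k) \<partial>M)"
    unfolding call_def
    by (intro Bochner_Integration.integral_cong) (use assms in \<open>auto split: split_indicator\<close>)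
  then show ?thesis using assms by (simp add: call_def)
qed

lemma measure_Un:
  assumes "A \<in> sets borel" "B \<in> sets borel" "A \<inter> B = {}"
  shows "measure M (A \<union> B) = measure M A + measure M B"
  using finite_measure_Union[of A B] assms by (simp add: M_is_borel)

lemma split_at:
  shows "measure M UNIV = measure M {..q} + measure M {q<..}"
    and "partial_mean M UNIV = partial_mean M {..q} + partial_mean M {q<..}"
    and "call M UNIV k = call M {..q} k + call M {q<..} k"
proof -
  have "UNIV = {..q} \<union> {q<..}" by auto
  then show "measure M UNIV = measure M {..q} + measure M {q<..}"
    "partial_mean M UNIV = partial_mean M {..q} + partial_mean M {q<..}"
    "call M UNIV k = call M {..q} k + call M {q<..} k"
    using measure_Un[of "{..q}" "{q<..}"] partial_mean_Un[of "{..q}" "{q<..}"]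
      call_Un[of "{..q}" "{q<..}" k] by force+
qed

lemma call_above:
  assumes "A \<in> sets borel" "\<And>x. x \<in> A \<Longrightarrow> k \<le> x"
  shows "call M A k = partial_mean M A - k * measure M A"
proof -
  have "call M A k = (\<integral>x. indicator A x * x - k * indicator A x \<partial>M)"
    unfolding call_def
    by (intro Bochner_Integration.integral_cong) (use assms in \<open>auto split: split_indicator\<close>)
  then show ?thesis using assms by (simp add: partial_mean_def M_is_borel)
qed

lemma call_below:
  assumes "\<And>x. x \<in> A \<Longrightarrow> x \<le> k"
  shows "call M A k = 0"
proof -
  have "call M A k = (\<integral>x. 0 \<partial>M)"
    unfolding call_def
    by (intro Bochner_Integration.integral_cong) (use assms in \<open>auto split: split_indicator\<close>)
  then show ?thesis by simp
qed

lemma call_ge_affine: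
  assumes "A \<in> sets borel"
  shows "partial_mean M A - k * measure M A \<le> call M A k"
proof -
  have "partial_mean M A - k * measure M A = (\<integral>x. indicator A x * x - k * indicator A x \<partial>M)"
    using assms by (simp add: partial_mean_def M_is_borel)
  also have "\<dots> \<le> call M A k"
    unfolding call_def using assms
    by (intro integral_mono) (auto split: split_indicator)
  finally show ?thesis .
qed

lemma call_mono:
  assumes "A \<in> sets borel" "B \<in> sets borel" "A \<subseteq> B"
  shows "call M A k \<le> call M B k"
  unfolding call_def using assms
  by (intro integral_mono) (auto split: split_indicator)

lemma call_antimono:
  assumes "A \<in> sets borel" "k \<le> l"
  shows "call M A l \<le> call M A k"
  unfolding call_def using assms
  by (intro integral_mono) (auto split: split_indicator)

lemma call_convex:
  assumes "A \<in> sets borel" "u \<le> k" "k \<le> v"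
  shows "(v - u) * call M A k \<le> (v - k) * call M A u + (k - u) * call M A v"
proof -
  have "(v - u) * call M A k = (\<integral>x. indicator A x * ((v - u) * max 0 (x - k)) \<partial>M)"
    unfolding call_def by (subst integral_mult_right_zero[symmetric]) (simp add: ac_simps)
  also have "\<dots> \<le> (\<integral>x. indicator A x * ((v - k) * max 0 (x - u) + (k - u) * max 0 (x - v)) \<partial>M)"
    using assms
    by (intro integral_mono mult_left_mono max_0_diff_convex_comb integrable_indicator_mult
        Bochner_Integration.integrable_add integrable_mult_right) auto
  also have "\<dots> = (\<integral>x. (v - k) * (indicator A x * max 0 (x - u)) + (k - u) * (indicator A x * max 0 (x - v)) \<partial>M)"
    by (intro Bochner_Integration.integral_cong) (auto simp: algebra_simps)
  also have "\<dots> = (v - k) * call M A u + (k - u) * call M A v"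
    using assms by (simp add: call_def)
  finally show ?thesis .
qed

text \<open>By put-call parity the two sides are the integrals of \<open>max 0 (k - x)\<close> and \<open>max 0 (l - x)\<close>
  over \<open>A\<close>.\<close>

lemma put_mono:
  assumes "A \<in> sets borel" "k \<le> l"
  shows "call M A k - partial_mean M A + k * measure M A \<le> call M A l - partial_mean M A + l * measure M A"
proof -
  have *: "call M A k - partial_mean M A + k * measure M A = (\<integral>x. indicator A x * max 0 (k - x) \<partial>M)" for k
  proof -
    have "(\<integral>x. indicator A x * max 0 (k - x) \<partial>M)
        = (\<integral>x. indicator A x * max 0 (x - k) - indicator A x * x + k * indicator A x \<partial>M)"
      by (intro Bochner_Integration.integral_cong) (auto split: split_indicator)
    then show ?thesis using assms by (simp add: call_def partial_mean_def M_is_borel)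
  qed
  have int: "integrable M (\<lambda>x. indicator A x * max 0 (k - x))" for k
    by (intro integrable_indicator_mult assms integrable_max Bochner_Integration.integrable_diff integrable_id) simp_all
  show ?thesis
    unfolding * using assms by (intro integral_mono int) (auto split: split_indicator)
qed

section \<open>Restriction to a Borel set and continuity of truncated integrals\<close>

lemma
  assumes A: "A \<in> sets borel"
  shows finite_mean_measure_restr: "finite_mean_measure (restr M A)"
    and measure_restr: "B \<in> sets borel \<Longrightarrow> measure (restr M A) B = measure M (A \<inter> B)"
    and partial_mean_restr: "B \<in> sets borel \<Longrightarrow> partial_mean (restr M A) B = partial_mean M (A \<inter> B)"
    and call_restr: "B \<in> sets borel \<Longrightarrow> call (restr M A) B k = call M (A \<inter> B) k"
proof -
  have [measurable]: "A \<in> sets borel" by fact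
  have em: "emeasure (restr M A) B = emeasure M (A \<inter> B)" if [measurable]: "B \<in> sets borel" for B
    unfolding restr_def by (subst emeasure_density) (use A that in \<open>auto simp: M_is_borel simp flip: indicator_inter_arith\<close>)
  have int: "(\<integral>x. f x \<partial>restr M A) = (\<integral>x. indicator A x * f x \<partial>M)"
    "integrable (restr M A) f \<longleftrightarrow> integrable M (\<lambda>x. indicator A x * f x)" if [measurable]: "f \<in> borel_measurable borel" for f :: "real \<Rightarrow> real"
  proof -
    have eq: "restr M A = density M (\<lambda>x. ennreal (indicator A x))"
      unfolding restr_def by (simp add: ennreal_indicator)
    show "(\<integral>x. f x \<partial>restr M A) = (\<integral>x. indicator A x * f x \<partial>M)"
      unfolding eq by (subst integral_density) auto
    show "integrable (restr M A) f \<longleftrightarrow> integrable M (\<lambda>x. indicator A x * f x)"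
      unfolding eq by (subst integrable_density) auto
  qed
  show "finite_mean_measure (restr M A)"
    unfolding finite_mean_measure_def finite_mean_measure_axioms_def finite_borel_measure_def
      finite_borel_measure_axioms_def
  proof (intro conjI finite_measureI)
    show "emeasure (restr M A) (space (restr M A)) \<noteq> \<infinity>"
      using em[of UNIV] by (simp add: restr_def)
    show "sets (restr M A) = sets borel" by (simp add: restr_def M_is_borel)
    show "integrable (restr M A) (\<lambda>x. x)" using A by (subst int) auto
  qed
  show "B \<in> sets borel \<Longrightarrow> measure (restr M A) B = measure M (A \<inter> B)"
    by (simp add: measure_def em)
  show "B \<in> sets borel \<Longrightarrow> partial_mean (restr M A) B = partial_mean M (A \<inter> B)"
    unfolding partial_mean_def by (subst int) (auto simp: indicator_inter_arith ac_simps)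
  show "B \<in> sets borel \<Longrightarrow> call (restr M A) B k = call M (A \<inter> B) k"
    unfolding call_def by (subst int) (auto simp: indicator_inter_arith ac_simps)
qed

text \<open>If \<open>u n\<close> tends to \<open>s\<close>, the indicators are eventually constant
  at every point with \<open>G x \<noteq> s\<close>; dominated convergence with bound
  \<open>\<bar>f x\<bar>\<close> does the rest. It serves for truncation by rank (\<open>G\<close> a
  distribution function) and by position (\<open>G\<close> the identity).\<close>

lemma continuous_integral_sublevel:
  fixes G f :: "real \<Rightarrow> real"
  assumes [measurable]: "G \<in> borel_measurable borel" and int: "integrable M f"
    and null: "AE x in M. G x \<noteq> s"
  shows "isCont (\<lambda>s. \<integral>x. indicator {x. G x \<le> s} x * f x \<partial>M) s"
proof (rule continuous_at_sequentiallyI)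
  fix u assume u: "u \<longlonglongrightarrow> s"
  have [measurable]: "f \<in> borel_measurable borel" using int by auto
  show "(\<lambda>n. \<integral>x. indicator {x. G x \<le> u n} x * f x \<partial>M) \<longlonglongrightarrow> (\<integral>x. indicator {x. G x \<le> s} x * f x \<partial>M)"
  proof (rule integral_dominated_convergence)
    show "integrable M (\<lambda>x. \<bar>f x\<bar>)" using int by simp
    show "AE x in M. (\<lambda>n. indicator {x. G x \<le> u n} x * f x) \<longlonglongrightarrow> indicator {x. G x \<le> s} x * f x"
      using null
    proof eventually_elim
      case (elim x)
      have "\<forall>\<^sub>F n in sequentially. indicator {x. G x \<le> u n} x = (indicator {x. G x \<le> s} x :: real)"
      proof (cases "G x < s")
        case True
        then show ?thesis using order_tendstoD(1)[OF u True] by (auto elim!: eventually_mono split: split_indicator)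
      next
        case False
        then have "s < G x" using elim by simp
        from order_tendstoD(2)[OF u this] \<open>s < G x\<close> show ?thesis by (auto elim!: eventually_mono split: split_indicator)
      qed
      then show ?case
        by (intro tendsto_mult_right tendsto_eventually)
    qed
  qed (auto split: split_indicator)
qed

end

section \<open>Distribution functions of atomless measures\<close>

context finite_mean_measure
begin

lemma atomless_AE_neq:
  assumes "atomless M"
  shows "AE x in M. x \<noteq> c"
  using AE_not_in[of "{c}" M] assms by (simp add: null_sets_def M_is_borel atomless_def)

lemma atomless_isCont_cdf:
  assumes "atomless M"
  shows "isCont (cdf M) x"
  using assms by (simp add: isCont_cdf atomless_def measure_def)

lemma cdf_measurable [measurable]: "cdf M \<in> borel_measurable borel"
  by (rule borel_measurable_mono) (auto simp: mono_def cdf_nondecreasing)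

text \<open>Intermediate value theorem. The bounds are strict because 0 and the total mass may be
  mere limits of the distribution function.\<close>

lemma atomless_cdf_eq:
  assumes "atomless M" "0 < s" "s < measure M UNIV"
  obtains q where "cdf M q = s"
proof -
  obtain a where a: "cdf M a < s"
    using order_tendstoD(2)[OF cdf_lim_at_bot assms(2)] by (auto simp: eventually_at_bot_linorder)
  obtain b where b: "s < cdf M b"
    using order_tendstoD(1)[OF cdf_lim_at_top, of s] assms(3) by (auto simp: eventually_at_top_linorder)
  have "a \<le> b" using a b cdf_nondecreasing[of b a] by linarith
  with a b obtain q where "cdf M q = s"
    using IVT[of "cdf M" a s b] atomless_isCont_cdf[OF assms(1)] by (auto simp: less_imp_le)
  then show ?thesis by (rule that)
qed

text \<open>The distribution function of an atomless measure is uniformly distributed under it. A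
  quantile ray at level \<open>s\<close> lies inside the sublevel set, and the rays at all levels
  \<open>s' > s\<close> contain it.\<close>

lemma measure_cdf_sublevel:
  assumes "atomless M" "0 \<le> s" "s \<le> measure M UNIV"
  shows "measure M {x. cdf M x \<le> s} = s"
proof -
  consider "s = measure M UNIV" | "s < measure M UNIV" using assms by linarith
  then show ?thesis
  proof cases
    case 1
    then have "{x. cdf M x \<le> s} = UNIV" using cdf_bounded by auto
    with 1 show ?thesis by simp
  next
    case 2
    have le: "measure M {x. cdf M x \<le> s} \<le> s'" if s': "s < s'" "s' < measure M UNIV" for s'
    proof -
      obtain q where q: "cdf M q = s'" using atomless_cdf_eq[OF assms(1), of s'] s' assms by auto
      have "{x. cdf M x \<le> s} \<subseteq> {..q}"
      proof
        fix x assume "x \<in> {x. cdf M x \<le> s}"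
        then show "x \<in> {..q}" using cdf_nondecreasing[of q x] q s' by (cases "q \<le> x") auto
      qed
      then have "measure M {x. cdf M x \<le> s} \<le> measure M {..q}"
        by (intro finite_measure_mono) (auto simp: M_is_borel)
      then show ?thesis using q by (simp add: cdf_def2)
    qed
    have "s \<le> measure M {x. cdf M x \<le> s}"
    proof (cases "s = 0")
      case False
      then obtain q where q: "cdf M q = s" using atomless_cdf_eq[OF assms(1), of s] 2 assms by auto
      have "measure M {..q} \<le> measure M {x. cdf M x \<le> s}"
        using q cdf_nondecreasing by (intro finite_measure_mono) (auto simp: M_is_borel)
      then show ?thesis using q by (simp add: cdf_def2)
    qed simp
    then show ?thesis using dense_ge_bounded[OF 2, of "measure M {x. cdf M x \<le> s}"] le by auto
  qed
qed

text \<open>A level set may be a whole interval, but it lies between the sublevel sets for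
  \<open>s - e\<close> and \<open>s\<close>, whose difference has mass \<open>e\<close>.\<close>

lemma AE_cdf_neq:
  assumes "atomless M"
  shows "AE x in M. cdf M x \<noteq> s"
proof -
  have "measure M {x. cdf M x = s} = 0"
  proof (cases "0 \<le> s \<and> s \<le> measure M UNIV")
    case False
    then have "{x. cdf M x = s} = {}" using cdf_bounded cdf_nonneg by auto
    then show ?thesis by simp
  next
    case True
    show ?thesis
    proof (cases "s = 0")
      case True
      then have "measure M {x. cdf M x = s} \<le> measure M {x. cdf M x \<le> s}"
        by (intro finite_measure_mono) (auto simp: M_is_borel)
      also have "\<dots> = 0" using True measure_cdf_sublevel[OF assms, of s] by simp
      finally show ?thesis by (simp add: measure_le_0_iff)
    next
      case False
      have "measure M {x. cdf M x = s} \<le> e" if "0 < e" "e < s" for e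
      proof -
        have "measure M {x. cdf M x = s} \<le> measure M ({x. cdf M x \<le> s} - {x. cdf M x \<le> s - e})"
          using that by (intro finite_measure_mono) (auto simp: M_is_borel)
        also have "\<dots> = measure M {x. cdf M x \<le> s} - measure M {x. cdf M x \<le> s - e}"
          using that by (intro finite_measure_Diff) (auto simp: M_is_borel)
        also have "\<dots> = e"
          using measure_cdf_sublevel[OF assms, of s] measure_cdf_sublevel[OF assms, of "s - e"] that True by simp
        finally show ?thesis .
      qed
      then have "measure M {x. cdf M x = s} \<le> 0" using dense_ge_bounded[of 0 s] True False by force
      then show ?thesis by (simp add: measure_le_0_iff)
    qed
  qed
  then have "{x. cdf M x = s} \<in> null_sets M" by (auto simp: null_sets_def M_is_borel emeasure_eq_measure)
  from AE_not_in[OF this] show ?thesis by simp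
qed

lemma partial_mean_cong_AE:
  assumes "A \<in> sets borel" "B \<in> sets borel" "AE x in M. x \<in> A \<longleftrightarrow> x \<in> B"
  shows "partial_mean M A = partial_mean M B"
  unfolding partial_mean_def using assms
  by (intro integral_cong_AE) (auto elim!: eventually_mono split: split_indicator)

lemma subset_eq_measure_AE:
  assumes "A \<in> sets borel" "B \<in> sets borel" "A \<subseteq> B" "measure M A = measure M B"
  shows "AE x in M. x \<in> A \<longleftrightarrow> x \<in> B"
proof -
  have "measure M (B - A) = 0" using assms by (subst finite_measure_Diff) (auto simp: M_is_borel)
  then have "B - A \<in> null_sets M" using assms by (auto simp: null_sets_def M_is_borel emeasure_eq_measure)
  from AE_not_in[OF this] show ?thesis using assms(3) by (auto elim!: eventually_mono)
qed

lemma partial_mean_null: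
  assumes "A \<in> sets borel" "measure M A = 0"
  shows "partial_mean M A = 0" "call M A k = 0"
proof -
  have "A \<in> null_sets M" using assms by (auto simp: null_sets_def M_is_borel emeasure_eq_measure)
  then have ae: "AE x in M. x \<notin> A" by (rule AE_not_in)
  have "partial_mean M A = (\<integral>x. 0 \<partial>M)" unfolding partial_mean_def using assms ae
    by (intro integral_cong_AE) (auto elim!: eventually_mono split: split_indicator)
  then show "partial_mean M A = 0" by simp
  have "call M A k = (\<integral>x. 0 \<partial>M)" unfolding call_def using assms ae
    by (intro integral_cong_AE) (auto elim!: eventually_mono split: split_indicator)
  then show "call M A k = 0" by simp
qed

text \<open>The sublevel set may exceed \<open>{..q}\<close> by a flat piece of the distribution
  function; both sets have mass \<open>s\<close>, so this piece is null.\<close>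

lemma partial_mean_cdf_sublevel:
  assumes "atomless M" "cdf M q = s"
  shows "partial_mean M {x. cdf M x \<le> s} = partial_mean M {..q}"
proof -
  have s: "0 \<le> s" "s \<le> measure M UNIV" using cdf_nonneg[of q] cdf_bounded[of q] assms(2) by auto
  have "AE x in M. x \<in> {..q} \<longleftrightarrow> x \<in> {x. cdf M x \<le> s}"
  proof (rule subset_eq_measure_AE)
    show "{..q} \<subseteq> {x. cdf M x \<le> s}" using assms(2) cdf_nondecreasing by auto
    show "measure M {..q} = measure M {x. cdf M x \<le> s}"
      using measure_cdf_sublevel[OF assms(1) s] assms(2) by (simp add: cdf_def2)
  qed simp_all
  then show ?thesis by (intro partial_mean_cong_AE) (auto elim!: eventually_mono)
qed

end

section \<open>Splitting the convex order\<close>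

text \<open>The interval \<open>J\<close> is found by sliding a window of mass \<open>\<alpha>\<close> until its barycentre is \<open>a\<close>.
  Over \<open>J\<close> the call function of the remaining measure is affine, so there it dominates the convex
  call function of \<open>M\<close> as soon as it does so at the endpoints.\<close>

lemma shadow_of_atom:
  assumes "finite_mean_measure M" "finite_mean_measure N" "atomless N" "0 \<le> \<alpha>"
    and mass: "measure N UNIV = measure M UNIV + \<alpha>"
    and mean: "partial_mean N UNIV = partial_mean M UNIV + \<alpha> * a"
    and call: "\<And>k. call M UNIV k + \<alpha> * max 0 (a - k) \<le> call N UNIV k"
  obtains J where "J \<in> sets borel" "measure N J = \<alpha>" "partial_mean N J = \<alpha> * a"
    "\<And>k. call M UNIV k \<le> call N (- J) k"
proof -
  note found = that
  interpret M: finite_mean_measure M by fact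
  interpret N: finite_mean_measure N by fact
  define m where "m = measure M UNIV"
  \<comment> \<open>\<open>I s\<close> is the first moment of the lowest mass \<open>s\<close> of
    \<open>N\<close>. The window of ranks from \<open>s\<close> to \<open>s + \<alpha>\<close> thus
    has first moment \<open>I (s + \<alpha>) - I s\<close>.\<close>
  define I where "I s = partial_mean N {x. cdf N x \<le> s}" for s
  have call': "call M UNIV k \<le> call N UNIV k" "call M UNIV k + \<alpha> * (a - k) \<le> call N UNIV k" for k
  proof -
    have "0 \<le> \<alpha> * max 0 (a - k)" "\<alpha> * (a - k) \<le> \<alpha> * max 0 (a - k)"
      using assms(4) by (auto intro: mult_left_mono)
    with call[of k] show "call M UNIV k \<le> call N UNIV k" "call M UNIV k + \<alpha> * (a - k) \<le> call N UNIV k"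
      by linarith+
  qed
  have above: "call N {q<..} q = partial_mean N {q<..} - q * measure N {q<..}" for q
    by (rule N.call_above) auto
  note split = N.split_at
  \<comment> \<open>In the third case the levels \<open>\<alpha>\<close> and \<open>m\<close> lie
    strictly between 0 and the total mass, so quantiles exist; the other two are settled by the
    empty set and the whole line.\<close>
  consider "\<alpha> = 0" | "m = 0" | "0 < \<alpha>" "0 < m"
    using assms(4) by (force simp: m_def zero_less_measure_iff)
  then show thesis
  proof cases
    case 1
    then show thesis by (intro found[of "{}"]) (use call' in \<open>auto simp: partial_mean_def\<close>)
  next
    case 2
    then have "partial_mean M UNIV = 0" "call M UNIV k = 0" for k
      using M.partial_mean_null[of UNIV] by (auto simp: m_def)
    then show thesis using 2 mass mean
      by (intro found[of UNIV]) (auto simp: m_def N.call_nonneg)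
  next
    case 3
    have q: "\<exists>q. cdf N q = s" if "0 < s" "s < m + \<alpha>" for s
      using N.atomless_cdf_eq[OF assms(3), of s] that mass by (metis m_def)
    have I0: "I 0 = 0"
      unfolding I_def using N.measure_cdf_sublevel[OF assms(3), of 0] mass 3
      by (intro N.partial_mean_null) (auto simp: m_def)
    have I1: "I (m + \<alpha>) = partial_mean N UNIV"
    proof -
      have "{x. cdf N x \<le> m + \<alpha>} = UNIV" using N.cdf_bounded mass by (auto simp: m_def)
      then show ?thesis by (simp add: I_def)
    qed
    have Iq: "I (cdf N q) = partial_mean N {..q}" for q
      unfolding I_def by (rule N.partial_mean_cdf_sublevel[OF assms(3) refl])
    \<comment> \<open>The lowest window has its barycentre at or below \<open>a\<close>: comparing
      calls at the quantile \<open>q\<close> shows that \<open>N\<close> has at least the first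
      moment of \<open>M\<close> above \<open>q\<close>.\<close>
    have low: "I \<alpha> \<le> \<alpha> * a"
    proof -
      obtain q where q: "cdf N q = \<alpha>" using q[of \<alpha>] 3 by auto
      have "partial_mean M UNIV - q * m \<le> call M UNIV q" unfolding m_def by (rule M.call_ge_affine) simp
      also have "\<dots> \<le> call N {q<..} q"
        using call'[of q] split(3)[of q q] N.call_below[of "{..q}" q] by simp
      also have "\<dots> = partial_mean N {q<..} - q * m"
        using above[of q] split(1)[of q] mass q by (simp add: m_def cdf_def2)
      finally show ?thesis using Iq[of q] split(2)[of q] mean q by simp
    qed
    \<comment> \<open>The highest window has its barycentre at or above \<open>a\<close>; here only
      the contribution of the atom to the call inequality is kept.\<close>
    have high: "\<alpha> * a \<le> I (m + \<alpha>) - I m"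
    proof -
      obtain q where q: "cdf N q = m" using q[of m] 3 by auto
      have "\<alpha> * (a - q) \<le> call N {q<..} q"
        using call'(2)[of q] M.call_nonneg[of UNIV q] split(3)[of q q] N.call_below[of "{..q}" q] by simp
      also have "\<dots> = partial_mean N {q<..} - q * \<alpha>"
        using above[of q] split(1)[of q] mass q by (simp add: m_def cdf_def2)
      finally show ?thesis using Iq[of q] split(2)[of q] q I1 by (simp add: algebra_simps)
    qed
    have contI: "isCont I s" for s
    proof -
      have "isCont (\<lambda>s. \<integral>x. indicator {x. cdf N x \<le> s} x * x \<partial>N) s"
        by (rule N.continuous_integral_sublevel[OF N.cdf_measurable N.integrable_id N.AE_cdf_neq[OF assms(3)]])
      then show ?thesis by (simp add: I_def[abs_def] partial_mean_def)
    qed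
    have "isCont (\<lambda>s. I (s + \<alpha>) - I s) s" for s
      by (intro continuous_intros isCont_o2[OF _ contI] contI)
    then obtain s where s: "0 \<le> s" "s \<le> m" "I (s + \<alpha>) - I s = \<alpha> * a"
      using IVT[of "\<lambda>s. I (s + \<alpha>) - I s" 0 "\<alpha> * a" m] low high I0 3 by auto
    \<comment> \<open>Only strikes with points of \<open>J\<close> on both sides need an argument.
      If \<open>J\<close> lies on one side of \<open>k\<close>, removing it lowers the call by
      \<open>\<alpha> * (a - k)\<close> or by 0, and both are covered by the assumed
      domination.\<close>
    have close: thesis
      if J: "J \<in> sets borel" "measure N J = \<alpha>" "partial_mean N J = \<alpha> * a"
        and inner: "\<And>k. \<not> J \<subseteq> {k..} \<Longrightarrow> \<not> J \<subseteq> {..k} \<Longrightarrow> call M UNIV k \<le> call N (- J) k" for J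
    proof (rule found[OF J])
      fix k
      have "call N UNIV k = call N J k + call N (- J) k"
        using N.call_Un[of J "- J" k] J(1) by (simp add: Compl_partition)
      moreover have "call N J k = \<alpha> * (a - k)" if "J \<subseteq> {k..}"
        using N.call_above[OF J(1), of k] that J by (force simp: algebra_simps)
      ultimately show "call M UNIV k \<le> call N (- J) k"
        using inner[of k] call'[of k] N.call_below[of J k] by fastforce
    qed
    consider "s = 0" | "s = m" | "0 < s" "s < m" using s by linarith
    then show thesis
    proof cases
      case 1
      obtain v where v: "cdf N v = \<alpha>" using q[of \<alpha>] 3 by auto
      have J: "measure N {..v} = \<alpha>" "partial_mean N {..v} = \<alpha> * a"
        using v Iq[of v] s 1 I0 by (auto simp: cdf_def2)
      have gt: "measure N {v<..} = m" "partial_mean N {v<..} = partial_mean M UNIV"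
        using split[of v] J mass mean by (auto simp: m_def)
      show thesis
      proof (rule close[OF _ J])
        fix k assume "\<not> {..v} \<subseteq> {k..}" "\<not> {..v} \<subseteq> {..k}"
        then have k: "k < v" by auto
        \<comment> \<open>The put of \<open>M\<close> at \<open>v\<close> comes out at most zero; as
          puts increase with the strike, so does the put at \<open>k\<close>.\<close>
        have "call M UNIV v \<le> call N {v<..} v"
          using call'(1)[of v] split(3)[of v v] N.call_below[of "{..v}" v] by simp
        also have "\<dots> = partial_mean M UNIV - v * m" using above[of v] gt by simp
        finally have "call M UNIV k \<le> partial_mean M UNIV - k * m"
          using M.put_mono[of UNIV k v] k by (simp add: m_def)
        also have "\<dots> = call N {v<..} k"
          using k gt by (subst N.call_above) auto
        finally show "call M UNIV k \<le> call N (- {..v}) k" by (simp add: Compl_atMost)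
      qed simp
    next
      case 2
      obtain u where u: "cdf N u = m" using q[of m] 3 by auto
      have J: "measure N {u<..} = \<alpha>" "partial_mean N {u<..} = \<alpha> * a"
        using u Iq[of u] s 2 I1 split[of u] mass by (auto simp: cdf_def2 m_def)
      show thesis
      proof (rule close[OF _ J])
        fix k assume "\<not> {u<..} \<subseteq> {k..}" "\<not> {u<..} \<subseteq> {..k}"
        then have k: "u < k" by (auto simp: subset_eq not_le)
        \<comment> \<open>The atom already uses up the whole call of \<open>N\<close> at
          \<open>u\<close>, so the call of \<open>M\<close> vanishes there and at every larger
          strike.\<close>
        have "call M UNIV u + \<alpha> * (a - u) \<le> call N {u<..} u"
          using call'(2)[of u] split(3)[of u u] N.call_below[of "{..u}" u] by simp
        also have "\<dots> = \<alpha> * (a - u)" using above[of u] J by (simp add: algebra_simps)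
        finally have "call M UNIV k \<le> 0" using M.call_antimono[of UNIV u k] k by simp
        then show "call M UNIV k \<le> call N (- {u<..}) k" using N.call_nonneg[of "- {u<..}" k] by linarith
      qed simp
    next
      case mid: 3
      obtain u where u: "cdf N u = s" using q[of s] 3 mid by auto
      obtain v where v: "cdf N v = s + \<alpha>" using q[of "s + \<alpha>"] 3 mid by auto
      have uv: "u < v" using N.cdf_nondecreasing[of v u] u v 3 by (cases "u < v") auto
      have un: "{..v} = {..u} \<union> {u<..v}" "{..u} \<inter> {u<..v} = {}" using uv by auto
      have J: "measure N {u<..v} = \<alpha>" "partial_mean N {u<..v} = \<alpha> * a"
        using N.measure_Un[of "{..u}" "{u<..v}"] N.partial_mean_Un[of "{..u}" "{u<..v}"] un
          u v Iq[of u] Iq[of v] s by (auto simp: cdf_def2)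
      \<comment> \<open>For strikes between \<open>u\<close> and \<open>v\<close> only the part of
        the complement above \<open>v\<close> pays, which makes its call the affine function
        \<open>P - k * Q\<close>.\<close>
      define P Q where "P = partial_mean N {v<..}" and "Q = measure N {v<..}"
      have R: "call N (- {u<..v}) k = P - k * Q" if "u \<le> k" "k \<le> v" for k
      proof -
        have "- {u<..v} = {..u} \<union> {v<..}" "{..u} \<inter> {v<..} = {}" using uv by auto
        then have "call N (- {u<..v}) k = call N {..u} k + call N {v<..} k"
          using N.call_Un[of "{..u}" "{v<..}" k] by simp
        moreover have "call N {..u} k = 0" using that by (intro N.call_below) auto
        moreover have "call N {v<..} k = P - k * Q"
          unfolding P_def Q_def using that by (intro N.call_above) auto
        ultimately show ?thesis by simp
      qed
      have sub: "call N UNIV k = call N {u<..v} k + call N (- {u<..v}) k" for k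
        using N.call_Un[of "{u<..v}" "- {u<..v}" k] by (simp add: Compl_partition)
      have Ru: "call M UNIV u \<le> P - u * Q"
      proof -
        have "call N {u<..v} u = \<alpha> * (a - u)"
          using N.call_above[of "{u<..v}" u] J by (auto simp: algebra_simps)
        then show ?thesis using sub[of u] R[of u] call'(2)[of u] uv by simp
      qed
      have Rv: "call M UNIV v \<le> P - v * Q"
        using sub[of v] R[of v] call'(1)[of v] uv N.call_below[of "{u<..v}" v] by auto
      show thesis
      proof (rule close[OF _ J])
        fix k assume "\<not> {u<..v} \<subseteq> {k..}" "\<not> {u<..v} \<subseteq> {..k}"
        then have k: "u < k" "k < v" by (auto simp: subset_eq not_le)
        have "(v - u) * call M UNIV k \<le> (v - k) * call M UNIV u + (k - u) * call M UNIV v"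
          using k by (intro M.call_convex) auto
        also have "\<dots> \<le> (v - k) * (P - u * Q) + (k - u) * (P - v * Q)"
          using k Ru Rv by (intro add_mono mult_left_mono) auto
        also have "\<dots> = (v - u) * (P - k * Q)" by (simp add: algebra_simps)
        finally have "call M UNIV k \<le> P - k * Q" using uv by simp
        then show "call M UNIV k \<le> call N (- {u<..v}) k" using R[of k] k by simp
      qed simp
    qed
  qed
qed

section \<open>Cutting a dominated measure at a point\<close>

lemma (in finite_mean_measure) atomless_restr:
  assumes "atomless M" "A \<in> sets borel"
  shows "atomless (restr M A)"
proof -
  interpret R: finite_mean_measure "restr M A" by (rule finite_mean_measure_restr[OF assms(2)])
  have "measure M (A \<inter> {x}) \<le> measure M {x}" for x
    using assms by (intro finite_measure_mono) (auto simp: M_is_borel)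
  moreover have "measure M {x} = 0" for x using assms(1) by (simp add: atomless_def measure_def)
  ultimately have "measure (restr M A) {x} = 0" for x
    using measure_restr[OF assms(2), of "{x}"] measure_nonneg[of M "A \<inter> {x}"]
    by (metis antisym borel_singleton sets.empty_sets)
  then show ?thesis by (simp add: atomless_def R.emeasure_eq_measure)
qed

text \<open>The point \<open>t \<ge> a\<close> is chosen such that the line \<open>k \<mapsto> \<integral>\<^bsub>y > t\<^esub> (y - k) \<partial>N\<close>, which is
  tangent at \<open>t\<close> to the call function of \<open>N\<close>, passes through the call function of \<open>M\<close> at \<open>a\<close>. Then
  \<open>N\<close> has an excess mass \<open>\<alpha>\<close> on \<open>{..t}\<close>, and \<open>M\<close> restricted to \<open>{..a}\<close> plus \<open>\<alpha>\<close> times the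
  Dirac mass at \<open>a\<close> is dominated there; removing the shadow of that atom gives \<open>B\<close>.\<close>

lemma cx_on_split_UNIV:
  assumes "finite_mean_measure M" "finite_mean_measure N" "atomless N" and cx: "cx_on M UNIV N UNIV"
  obtains B where "B \<in> sets borel" "cx_on M {..a} N B" "cx_on M {a<..} N (- B)"
proof -
  note found = that
  interpret M: finite_mean_measure M by fact
  interpret N: finite_mean_measure N by fact
  note splitM = M.split_at
  note splitN = N.split_at
  have cx: "measure M UNIV = measure N UNIV" "partial_mean M UNIV = partial_mean N UNIV"
    "call M UNIV k \<le> call N UNIV k" for k
    using cx by (auto simp: cx_on_def)
  define K where "K = call M UNIV a"
  have KM: "K = partial_mean M {a<..} - a * measure M {a<..}"
    unfolding K_def using splitM(3)[of a a] M.call_below[of "{..a}" a] M.call_above[of "{a<..}" a] by auto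
  show thesis
  proof (cases "K = 0")
    case True
    \<comment> \<open>For \<open>K = 0\<close> there is no mass of \<open>M\<close> above
      \<open>a\<close>, and the whole line serves as \<open>B\<close>.\<close>
    have "AE x in M. max 0 (x - a) = 0"
      using True unfolding K_def call_def
      by (subst (asm) integral_nonneg_eq_0_iff_AE) auto
    then have "AE x in M. x \<notin> {a<..}" by (auto elim!: eventually_mono)
    then have "measure M {a<..} = 0"
      using AE_iff_null_sets[of "{a<..}" M] by (auto simp: M.M_is_borel null_sets_def measure_def)
    then have "measure M {a<..} = 0" "partial_mean M {a<..} = 0" "call M {a<..} k = 0" for k
      using M.partial_mean_null[of "{a<..}"] by auto
    then show thesis
      using cx splitM(1,2)[of a] splitM(3)[of _ a]
      by (intro found[of UNIV]) (auto simp: cx_on_def partial_mean_def call_def)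
  next
    case False
    then have K: "0 < K" using M.call_nonneg[of UNIV a] by (simp add: K_def)
    \<comment> \<open>\<open>T t\<close> is the value at strike \<open>a\<close> of the line
      belonging to \<open>t\<close>. It is at least \<open>K\<close> for \<open>t = a\<close> and
      tends to 0 as \<open>t\<close> grows, so by continuity it takes the value
      \<open>K\<close>.\<close>
    define T where "T t = partial_mean N {t<..} - a * measure N {t<..}" for t
    have T_eq: "T t = (\<integral>x. indicator {t<..} x * (x - a) \<partial>N)" for t
    proof -
      have "(\<integral>x. indicator {t<..} x * (x - a) \<partial>N) = (\<integral>x. indicator {t<..} x * x - a * indicator {t<..} x \<partial>N)"
        by (intro Bochner_Integration.integral_cong) (auto simp: algebra_simps)
      then show ?thesis by (simp add: T_def partial_mean_def N.M_is_borel)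
    qed
    have int: "integrable N (\<lambda>x. x - a)" by (intro Bochner_Integration.integrable_diff N.integrable_id) simp
    have T_eq': "T t = (\<integral>x. x - a \<partial>N) - (\<integral>x. indicator {x. x \<le> t} x * (x - a) \<partial>N)" for t
      unfolding T_eq
      by (subst Bochner_Integration.integral_diff[symmetric])
        (auto intro!: Bochner_Integration.integral_cong int N.integrable_indicator_mult split: split_indicator)
    have contT: "isCont T t" for t
      unfolding T_eq'[abs_def]
      by (intro continuous_intros N.continuous_integral_sublevel int N.atomless_AE_neq assms) auto
    have "(\<lambda>n. T (real n)) \<longlonglongrightarrow> (\<integral>x. 0 \<partial>N)"
      unfolding T_eq
    proof (rule integral_dominated_convergence)
      show "integrable N (\<lambda>x. \<bar>x - a\<bar>)" using int by simp
      show "AE x in N. (\<lambda>n. indicator {real n<..} x * (x - a)) \<longlonglongrightarrow> 0"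
      proof (rule AE_I2, rule tendsto_eventually)
        fix x :: real
        obtain n0 where "x \<le> real n0" using real_arch_simple by blast
        then show "\<forall>\<^sub>F n in sequentially. indicator {real n<..} x * (x - a) = 0"
          unfolding eventually_sequentially by (intro exI[of _ n0]) (auto split: split_indicator)
      qed
    qed (auto split: split_indicator)
    then have "\<forall>\<^sub>F n in sequentially. T (real n) < K"
      using order_tendstoD(2)[of _ 0 _ K] K by simp
    then have "\<forall>\<^sub>F n in sequentially. T (real n) < K \<and> a \<le> real n"
      using eventually_ge_at_top[of "nat \<lceil>a\<rceil>"] by eventually_elim linarith
    then obtain b where b: "T b < K" "a \<le> b" by (auto simp: eventually_sequentially)
    have "K \<le> T a"
      using cx(3)[of a] splitN(3)[of a a] N.call_below[of "{..a}" a] N.call_above[of "{a<..}" a]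
      by (auto simp: K_def T_def)
    then obtain t where t: "a \<le> t" "T t = K"
      using IVT2[of T b K a] b contT by auto
    have T_mono: "T k \<le> T t" if "t \<le> k" for k
      unfolding T_eq using that t
      by (intro integral_mono N.integrable_indicator_mult int) (auto split: split_indicator)
    define \<alpha> where "\<alpha> = measure M {a<..} - measure N {t<..}"
    \<comment> \<open>Two lines through the point \<open>(a, K)\<close> are compared at strike
      \<open>k\<close>, which orders their slopes after division by \<open>k - a > 0\<close>. The
      division requires \<open>k\<close> strictly above \<open>a\<close>, whence
      \<open>t < k\<close>; the case of \<open>t\<close> itself follows by right continuity of the
      distribution function.\<close>
    have tail: "measure N {k<..} \<le> measure M {a<..}" if "t < k" for k
    proof -
      have "K - (k - a) * measure M {a<..} = partial_mean M {a<..} - k * measure M {a<..}"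
        by (simp add: KM algebra_simps)
      also have "\<dots> \<le> call M {a<..} k" by (rule M.call_ge_affine) simp
      also have "\<dots> \<le> call M UNIV k" by (rule M.call_mono) auto
      also have "\<dots> \<le> call N UNIV k" by (rule cx)
      also have "\<dots> = T k - (k - a) * measure N {k<..}"
        using splitN(3)[of k k] N.call_below[of "{..k}" k] N.call_above[of "{k<..}" k]
        by (auto simp: T_def algebra_simps)
      also have "\<dots> \<le> K - (k - a) * measure N {k<..}" using T_mono[of k] that t by simp
      finally show ?thesis using that t by simp
    qed
    have "measure N UNIV - measure M {a<..} \<le> cdf N t"
    proof (rule tendsto_lowerbound)
      show "(cdf N \<longlongrightarrow> cdf N t) (at_right t)"
        using N.cdf_is_right_cont[of t] by (simp add: continuous_within)
      show "\<forall>\<^sub>F k in at_right t. measure N UNIV - measure M {a<..} \<le> cdf N k"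
        using eventually_at_right_less[of t]
      proof eventually_elim
        case (elim k)
        then show ?case using tail[of k] splitN(1)[of k] by (simp add: cdf_def2)
      qed
    qed simp
    then have \<alpha>: "0 \<le> \<alpha>" using splitN(1)[of t] by (simp add: \<alpha>_def cdf_def2)
    have line: "partial_mean N {t<..} - k * measure N {t<..} = K - (k - a) * measure N {t<..}" for k
      using t(2) by (simp add: T_def algebra_simps)
    have mass: "measure N {..t} = measure M {..a} + \<alpha>"
      using splitM(1)[of a] splitN(1)[of t] cx(1) by (simp add: \<alpha>_def)
    \<comment> \<open>The surplus of \<open>N\<close> has barycentre exactly \<open>a\<close>
      because both lines, with slopes given by the masses of \<open>{a<..}\<close> and
      \<open>{t<..}\<close>, take the value \<open>K\<close> at \<open>a\<close>.\<close>
    have mean: "partial_mean N {..t} = partial_mean M {..a} + \<alpha> * a"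
      using splitM(2)[of a] splitN(2)[of t] cx(2) line[of 0] KM by (simp add: \<alpha>_def algebra_simps)
    have call: "call M {..a} k + \<alpha> * max 0 (a - k) \<le> call N {..t} k" for k
    proof (cases "a \<le> k")
      case True
      then show ?thesis using M.call_below[of "{..a}" k] N.call_nonneg by simp
    next
      case False
      \<comment> \<open>Below \<open>a\<close> both upper calls are affine; subtracting them from
        the global inequality leaves the term of the atom.\<close>
      have "call M {a<..} k = partial_mean M {a<..} - k * measure M {a<..}"
        "call N {t<..} k = K - (k - a) * measure N {t<..}"
        unfolding line[symmetric] using False t by (intro M.call_above N.call_above; auto)+
      then show ?thesis
        using False splitM(3)[of k a] splitN(3)[of k t] cx(3)[of k] KM
        by (simp add: \<alpha>_def algebra_simps)
    qed
    obtain J where J0: "J \<in> sets borel" "measure (restr N {..t}) J = \<alpha>"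
      "partial_mean (restr N {..t}) J = \<alpha> * a"
      "\<And>k. call (restr M {..a}) UNIV k \<le> call (restr N {..t}) (- J) k"
    proof (rule shadow_of_atom[of "restr M {..a}" "restr N {..t}" \<alpha> a])
      show "finite_mean_measure (restr M {..a})" by (rule M.finite_mean_measure_restr) simp
      show "finite_mean_measure (restr N {..t})" by (rule N.finite_mean_measure_restr) simp
      show "atomless (restr N {..t})" by (rule N.atomless_restr) (use assms in auto)
    qed (use \<alpha> mass mean call in \<open>auto simp: M.measure_restr N.measure_restr
        M.partial_mean_restr N.partial_mean_restr M.call_restr N.call_restr\<close>)
    \<comment> \<open>\<open>J\<close> is controlled only through the restriction to
      \<open>{..t}\<close>, so it is cut down to that ray.\<close>
    define J' where "J' = {..t} \<inter> J"
    have J: "J' \<in> sets borel" "J' \<subseteq> {..t}" "measure N J' = \<alpha>" "partial_mean N J' = \<alpha> * a"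
      "call M {..a} k \<le> call N ({..t} - J') k" for k
    proof -
      have "{..t} - J' = {..t} \<inter> - J" by (auto simp: J'_def)
      then show "J' \<in> sets borel" "J' \<subseteq> {..t}" "measure N J' = \<alpha>" "partial_mean N J' = \<alpha> * a"
        "call M {..a} k \<le> call N ({..t} - J') k"
        using J0(1,2,3) J0(4)[of k]
        by (auto simp: J'_def M.measure_restr N.measure_restr
          M.partial_mean_restr N.partial_mean_restr M.call_restr N.call_restr)
    qed
    define B where "B = {..t} - J'"
    have B: "B \<in> sets borel" "measure N B = measure N {..t} - \<alpha>"
      "partial_mean N B = partial_mean N {..t} - \<alpha> * a"
    proof -
      have "{..t} = B \<union> J'" "B \<inter> J' = {}" using J(2) by (auto simp: B_def)
      moreover show "B \<in> sets borel" using J by (simp add: B_def)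
      ultimately show "measure N B = measure N {..t} - \<alpha>"
        "partial_mean N B = partial_mean N {..t} - \<alpha> * a"
        using N.measure_Un[of B J'] N.partial_mean_Un[of B J'] J by auto
    qed
    have B': "measure N (- B) = measure N {t<..} + \<alpha>"
      "partial_mean N (- B) = partial_mean N {t<..} + \<alpha> * a"
      "call N (- B) k = call N {t<..} k + call N J' k" for k
    proof -
      have "- B = {t<..} \<union> J'" "{t<..} \<inter> J' = {}" using J(2) by (auto simp: B_def)
      then show "measure N (- B) = measure N {t<..} + \<alpha>"
        "partial_mean N (- B) = partial_mean N {t<..} + \<alpha> * a"
        "call N (- B) k = call N {t<..} k + call N J' k"
        using N.measure_Un[of "{t<..}" J'] N.partial_mean_Un[of "{t<..}" J']
          N.call_Un[of "{t<..}" J'] J by auto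
    qed
    show thesis
    proof (rule found[OF B(1)])
      show "cx_on M {..a} N B" using B J(5) mass mean by (simp add: cx_on_def B_def)
      have "call M {a<..} k \<le> call N {t<..} k + call N J' k" for k
      proof -
        \<comment> \<open>Above \<open>t\<close> the lower part of \<open>N\<close> pays nothing.
          Between \<open>a\<close> and \<open>t\<close> the convex call of \<open>M\<close> lies
          below its chord, while the call of \<open>N\<close> on \<open>{t<..}\<close> is affine.
          Below \<open>a\<close> the upper calls are affine and \<open>J'\<close> pays at least
          \<open>\<alpha> * (a - k)\<close>.\<close>
        consider "t \<le> k" | "a \<le> k" "k < t" | "k < a" by linarith
        then show ?thesis
        proof cases
          case 1
          then have "call N {..t} k = 0" by (intro N.call_below) auto
          then show ?thesis
            using M.call_mono[of "{a<..}" UNIV k] cx(3)[of k] splitN(3)[of k t] N.call_nonneg[of J' k] by simp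
        next
          case 2
          have "call M {a<..} t \<le> call M UNIV t" by (rule M.call_mono) auto
          also have "\<dots> \<le> call N {t<..} t"
            using cx(3)[of t] splitN(3)[of t t] N.call_below[of "{..t}" t] by simp
          also have "\<dots> = K - (t - a) * measure N {t<..}"
            unfolding line[symmetric] by (rule N.call_above) auto
          finally have mt: "call M {a<..} t \<le> K - (t - a) * measure N {t<..}" .
          have ma: "call M {a<..} a = K" unfolding KM by (rule M.call_above) auto
          have "(t - a) * call M {a<..} k \<le> (t - k) * call M {a<..} a + (k - a) * call M {a<..} t"
            using 2 by (intro M.call_convex) auto
          also have "\<dots> \<le> (t - k) * K + (k - a) * (K - (t - a) * measure N {t<..})"
            using 2 ma mt by (intro add_mono mult_left_mono) auto
          also have "\<dots> = (t - a) * (K - (k - a) * measure N {t<..})" by (simp add: algebra_simps)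
          finally have "call M {a<..} k \<le> K - (k - a) * measure N {t<..}" using 2 by simp
          also have "\<dots> = call N {t<..} k"
            unfolding line[symmetric] using 2 by (intro N.call_above[symmetric]) auto
          finally show ?thesis using N.call_nonneg[of J' k] by simp
        next
          case 3
          have "call M {a<..} k = partial_mean M {a<..} - k * measure M {a<..}"
            "call N {t<..} k = K - (k - a) * measure N {t<..}"
            unfolding line[symmetric] using 3 t by (intro M.call_above N.call_above; auto)+
          moreover have "\<alpha> * a - k * \<alpha> \<le> call N J' k"
            using N.call_ge_affine[OF J(1), of k] J by simp
          ultimately show ?thesis using KM by (simp add: \<alpha>_def algebra_simps)
        qed
      qed
      moreover have "measure M {a<..} = measure N {t<..} + \<alpha>" by (simp add: \<alpha>_def)
      moreover have "partial_mean M {a<..} = partial_mean N {t<..} + \<alpha> * a"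
        using KM line[of 0] by (simp add: \<alpha>_def algebra_simps)
      ultimately show "cx_on M {a<..} N (- B)" by (simp add: cx_on_def B')
    qed
  qed
qed

text \<open>The relative version follows by applying the cut to the restrictions to \<open>I\<close>
  and \<open>A\<close>; this is the step that can be iterated.\<close>

lemma cx_on_split:
  assumes "finite_mean_measure M" "finite_mean_measure N" "atomless N"
    and I: "I \<in> sets borel" and A: "A \<in> sets borel" and "cx_on M I N A"
  obtains B where "B \<in> sets borel" "cx_on M (I \<inter> {..a}) N (A \<inter> B)" "cx_on M (I - {..a}) N (A - B)"
proof -
  interpret M: finite_mean_measure M by fact
  interpret N: finite_mean_measure N by fact
  note restr = M.measure_restr[OF I] M.partial_mean_restr[OF I] M.call_restr[OF I]
    N.measure_restr[OF A] N.partial_mean_restr[OF A] N.call_restr[OF A]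
  have "cx_on (restr M I) UNIV (restr N A) UNIV"
    using assms(6) by (simp add: cx_on_def restr)
  from cx_on_split_UNIV[OF M.finite_mean_measure_restr[OF I] N.finite_mean_measure_restr[OF A]
      N.atomless_restr[OF assms(3) A] this, of a]
  obtain B where "B \<in> sets borel" "cx_on (restr M I) {..a} (restr N A) B"
    "cx_on (restr M I) {a<..} (restr N A) (- B)" .
  moreover have "I \<inter> {a<..} = I - {..a}" "A \<inter> - B = A - B" by auto
  ultimately show thesis
    by (intro that[of B]) (simp_all add: cx_on_def restr)
qed

section \<open>Backward Monge martingale transports\<close>

text \<open>Nodes of a binary tree of nested sets are words, latest branching first.\<close>

primrec cell :: "(bool list \<Rightarrow> 'a set) \<Rightarrow> bool list \<Rightarrow> 'a set" where
  "cell E [] = UNIV"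
| "cell E (b # w) = (if b then cell E w \<inter> E w else cell E w - E w)"

primrec address :: "(bool list \<Rightarrow> 'a set) \<Rightarrow> 'a \<Rightarrow> nat \<Rightarrow> bool list" where
  "address E x 0 = []"
| "address E x (Suc n) = (x \<in> E (address E x n)) # address E x n"

section \<open>Addresses in a tree of nested sets\<close>

lemma length_address [simp]: "length (address E x n) = n"
  by (induction n) auto

text \<open>Hence the cells of words of one fixed length partition the space.\<close>

lemma cell_eq_address: "cell E w = {x. address E x (length w) = w}"
  by (induction w) auto

lemma rev_address_nth: "i < n \<Longrightarrow> rev (address E x n) ! i \<longleftrightarrow> x \<in> E (address E x i)"
  by (induction n) (auto simp: nth_append less_Suc_eq)

lemma cell_borel: "(\<And>w. E w \<in> sets borel) \<Longrightarrow> cell E w \<in> sets borel"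
  by (induction w) auto

text \<open>An event depending on the first \<open>n\<close> answers is a finite disjoint union of
  cells, and mass and first moment are additive.\<close>

lemma address_transfer:
  assumes "finite_mean_measure M" "finite_mean_measure N"
    and E: "\<And>w. E w \<in> sets borel" and F: "\<And>w. F w \<in> sets borel"
    and cell: "\<And>w. measure M (cell E w) = measure N (cell F w)"
      "\<And>w. partial_mean M (cell E w) = partial_mean N (cell F w)"
  shows "{x. R (address E x n)} \<in> sets borel"
    and "measure M {x. R (address E x n)} = measure N {y. R (address F y n)}"
    and "partial_mean M {x. R (address E x n)} = partial_mean N {y. R (address F y n)}"
proof -
  interpret M: finite_mean_measure M by fact
  interpret N: finite_mean_measure N by fact
  define W where "W = {w. length w = n \<and> R w}"
  have "finite W"
    by (rule finite_subset[OF _ finite_lists_length_eq[of "UNIV :: bool set" n]]) (auto simp: W_def)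
  have UN: "{x. R (address G x n)} = (\<Union>w\<in>W. cell G w)" for G :: "bool list \<Rightarrow> real set"
    by (auto simp: cell_eq_address W_def)
  have "\<forall>w\<in>W. length w = n" by (simp add: W_def)
  with \<open>finite W\<close> have "(\<Union>w\<in>W. cell E w) \<in> sets borel \<and> (\<Union>w\<in>W. cell F w) \<in> sets borel \<and>
    measure M (\<Union>w\<in>W. cell E w) = measure N (\<Union>w\<in>W. cell F w) \<and>
    partial_mean M (\<Union>w\<in>W. cell E w) = partial_mean N (\<Union>w\<in>W. cell F w)"
  proof (induction W)
    case empty
    then show ?case by (simp add: partial_mean_def)
  next
    case (insert w W)
    have disj: "cell G w \<inter> (\<Union>w\<in>W. cell G w) = {}" for G :: "bool list \<Rightarrow> real set"
      using insert by (auto simp: cell_eq_address)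
    show ?case
      using insert M.measure_Un[OF _ _ disj[of E]] N.measure_Un[OF _ _ disj[of F]]
        M.partial_mean_Un[OF _ _ disj[of E]] N.partial_mean_Un[OF _ _ disj[of F]]
      by (auto simp: cell cell_borel E F)
  qed
  then show "{x. R (address E x n)} \<in> sets borel"
    "measure M {x. R (address E x n)} = measure N {y. R (address F y n)}"
    "partial_mean M {x. R (address E x n)} = partial_mean N {y. R (address F y n)}"
    by (simp_all add: UN)
qed

text \<open>The enumeration \<open>q\<close> need not be monotone, so each new cut has to be made in
  every cell formed so far, which gives a binary tree. The cuts of \<open>M\<close> are the rays,
  those of \<open>N\<close> come from \<open>cx_on_split\<close>, and corresponding cells stay in
  convex order. \<open>B i\<close> gathers the points of \<open>N\<close> whose answer at stage
  \<open>i\<close> is yes.\<close>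

lemma sublevel_family:
  fixes q :: "nat \<Rightarrow> real"
  assumes M: "finite_mean_measure M" and N: "finite_mean_measure N"
    and "atomless N" "cx_on M UNIV N UNIV"
  obtains B where "\<And>i. B i \<in> sets borel" "\<And>i. measure N (B i) = measure M {..q i}"
    "\<And>i. partial_mean N (B i) = partial_mean M {..q i}"
    "\<And>i j. q i \<le> q j \<Longrightarrow> measure N (B i - B j) = 0"
proof -
  interpret M: finite_mean_measure M by fact
  interpret N: finite_mean_measure N by fact
  have "\<exists>B. I \<in> sets borel \<and> A \<in> sets borel \<and> cx_on M I N A \<longrightarrow>
      B \<in> sets borel \<and> cx_on M (I \<inter> {..a}) N (A \<inter> B) \<and> cx_on M (I - {..a}) N (A - B)" for I A a
    using cx_on_split[OF M N \<open>atomless N\<close>] by metis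
  then obtain S where S: "\<And>I A a. I \<in> sets borel \<Longrightarrow> A \<in> sets borel \<Longrightarrow> cx_on M I N A \<Longrightarrow>
      S I A a \<in> sets borel \<and> cx_on M (I \<inter> {..a}) N (A \<inter> S I A a) \<and> cx_on M (I - {..a}) N (A - S I A a)"
    by metis
  define E where "E w = {..q (length w)}" for w :: "bool list"
  \<comment> \<open>The cut of \<open>N\<close> at a node depends on the cell already formed there.
    The cells are therefore built first by recursion and afterwards recognised as the cells of the
    tree \<open>F\<close>.\<close>
  define A where "A = rec_list UNIV (\<lambda>b w A. let B = S (cell E w) A (q (length w)) in if b then A \<inter> B else A - B)"
  define F where "F w = S (cell E w) (A w) (q (length w))" for w
  have A_eq: "A w = cell F w" for w
    by (induction w) (auto simp: A_def F_def Let_def)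
  have E_borel: "E w \<in> sets borel" for w by (simp add: E_def)
  have step: "F w \<in> sets borel \<and> cx_on M (cell E w \<inter> E w) N (cell F w \<inter> F w) \<and>
      cx_on M (cell E w - E w) N (cell F w - F w)"
    if "cell F w \<in> sets borel" "cx_on M (cell E w) N (cell F w)" for w
  proof -
    have "F w = S (cell E w) (cell F w) (q (length w))" "E w = {..q (length w)}"
      by (simp_all add: F_def A_eq E_def)
    then show ?thesis using S[OF cell_borel[of E w, OF E_borel] that] by metis
  qed
  have cx: "cell F w \<in> sets borel \<and> cx_on M (cell E w) N (cell F w)" for w
  proof (induction w)
    case Nil
    then show ?case using assms(4) by simp
  next
    case (Cons b w)
    then show ?case using step[of w] by auto
  qed
  have F_borel: "F w \<in> sets borel" for w
    using step[of w] cx[of w] by auto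
  have cell: "measure M (cell E w) = measure N (cell F w)"
    "partial_mean M (cell E w) = partial_mean N (cell F w)" for w
    using cx[of w] by (auto simp: cx_on_def)
  note transfer = address_transfer[OF M N E_borel F_borel cell]
  note borelF = address_transfer(1)[OF N M F_borel E_borel cell[symmetric]]
  define B where "B i = {y. y \<in> F (address F y i)}" for i
  \<comment> \<open>The head of an address of length \<open>Suc i\<close> is its latest answer, the
    one of stage \<open>i\<close>.\<close>
  have B_eq: "B i = {y. hd (address F y (Suc i))}" "{..q i} = {x. hd (address E x (Suc i))}" for i
    by (auto simp: B_def E_def)
  show thesis
  proof (rule that[of B])
    fix i j
    show "B i \<in> sets borel" unfolding B_eq by (rule borelF)
    show "measure N (B i) = measure M {..q i}" "partial_mean N (B i) = partial_mean M {..q i}"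
      unfolding B_eq by (rule transfer(2,3)[symmetric])+
    assume le: "q i \<le> q j"
    \<comment> \<open>A length at which one address contains both answers. Yes at \<open>i\<close>
      and no at \<open>j\<close> is impossible for the rays, so the event has mass zero for
      \<open>N\<close>.\<close>
    define n where "n = Suc (max i j)"
    have ij: "i < n" "j < n" by (auto simp: n_def)
    have "B i - B j = {y. rev (address F y n) ! i \<and> \<not> rev (address F y n) ! j}"
      by (auto simp: B_def rev_address_nth ij)
    moreover have "{x. rev (address E x n) ! i \<and> \<not> rev (address E x n) ! j} = {}"
      using le by (auto simp: rev_address_nth ij E_def)
    ultimately show "measure N (B i - B j) = 0"
      using transfer(2)[of "\<lambda>w. rev w ! i \<and> \<not> rev w ! j" n] by (simp only: measure_empty)
  qed
qed

section \<open>Construction of the transport map\<close>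

text \<open>A Dynkin class argument over the intersection-stable generator of rays. The whole line
  is not a ray, so the complement step draws on \<open>mean\<close>.\<close>

lemma set_integral_preimage_eq_0:
  fixes f h :: "'a \<Rightarrow> real"
  assumes h: "h \<in> borel_measurable M" and f: "integrable M f" and mean: "(\<integral>x. f x \<partial>M) = 0"
    and zero: "\<And>c. (LINT x:h -` {..c} \<inter> space M|M. f x) = 0"
    and S: "S \<in> sets borel"
  shows "(LINT x:h -` S \<inter> space M|M. f x) = 0"
proof -
  have borel: "sets borel = sigma_sets UNIV (range (\<lambda>a::real. {..a}))"
    by (subst borel_eq_atMost) (rule sets_measure_of, simp)
  have pre: "h -` A \<inter> space M \<in> sets M" if "A \<in> sigma_sets UNIV (range (\<lambda>a::real. {..a}))" for A
    by (rule measurable_sets[OF h]) (simp only: borel that)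
  have set_int: "set_integrable M A f" if "A \<in> sets M" for A
    unfolding set_integrable_def using f that by (intro integrable_mult_indicator)
  have "S \<in> sigma_sets UNIV (range (\<lambda>a::real. {..a}))" using S by (simp only: borel)
  then show ?thesis
  proof (rule sigma_sets_induct_disjoint[rotated 2])
    show "Int_stable (range (\<lambda>a::real. {..a}))" by (auto simp: Int_stable_def)
    show "range (\<lambda>a::real. {..a}) \<subseteq> Pow UNIV" by simp
  next
    fix A assume "A \<in> range (\<lambda>a::real. {..a})"
    then show "(LINT x:h -` A \<inter> space M|M. f x) = 0" using zero by blast
  next
    show "(LINT x:h -` {} \<inter> space M|M. f x) = 0" by (simp add: set_lebesgue_integral_def)
  next
    fix A assume A: "A \<in> sigma_sets UNIV (range (\<lambda>a::real. {..a}))"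
      "(LINT x:h -` A \<inter> space M|M. f x) = 0"
    have "(LINT x:h -` (UNIV - A) \<inter> space M|M. f x)
        = (\<integral>x. f x - indicator (h -` A \<inter> space M) x *\<^sub>R f x \<partial>M)"
      unfolding set_lebesgue_integral_def
      by (intro Bochner_Integration.integral_cong) (auto split: split_indicator)
    also have "\<dots> = (\<integral>x. f x \<partial>M) - (LINT x:h -` A \<inter> space M|M. f x)"
      unfolding set_lebesgue_integral_def
      using f set_int[OF pre[OF A(1)]] by (intro Bochner_Integration.integral_diff) (simp_all add: set_integrable_def)
    finally show "(LINT x:h -` (UNIV - A) \<inter> space M|M. f x) = 0" using mean A(2) by simp
  next
    fix A :: "nat \<Rightarrow> real set"
    assume A: "disjoint_family A" "range A \<subseteq> sigma_sets UNIV (range (\<lambda>a::real. {..a}))"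
      "\<And>i. (LINT x:h -` A i \<inter> space M|M. f x) = 0"
    have hA: "h -` A i \<inter> space M \<in> sets M" for i using A(2) by (intro pre) blast
    have "h -` (\<Union>i. A i) \<inter> space M = (\<Union>i. h -` A i \<inter> space M)" by blast
    moreover have "(LINT x:(\<Union>i. h -` A i \<inter> space M)|M. f x) = (\<Sum>i. LINT x:h -` A i \<inter> space M|M. f x)"
    proof (rule lebesgue_integral_countable_add[OF hA])
      show "(h -` A i \<inter> space M) \<inter> (h -` A j \<inter> space M) = {}" if "i \<noteq> j" for i j
        using disjoint_family_onD[OF A(1) _ _ that] by blast
      show "set_integrable M (\<Union>i. h -` A i \<inter> space M) f" by (intro set_int sets.countable_UN) (use hA in blast)
    qed
    ultimately show "(LINT x:h -` (\<Union>i. A i) \<inter> space M|M. f x) = 0" using A(3) by simp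
  qed
qed

text \<open>\<open>h\<close> is a generalised inverse of the increasing family \<open>B\<close>. The
  masses of its sublevel sets identify its law, and their first moments give the martingale
  property, first on rays and then on all Borel sets.\<close>

lemma monge_map_exists:
  assumes M: "finite_mean_measure M" and N: "finite_mean_measure N"
    and "atomless N" "cx_on M UNIV N UNIV"
  obtains h :: "real \<Rightarrow> real" where "h \<in> borel_measurable borel" "distr N borel h = M"
    "\<And>S. S \<in> sets borel \<Longrightarrow> (LINT y:h -` S|N. y) = (LINT y:h -` S|N. h y)"
proof -
  interpret M: finite_mean_measure M by fact
  interpret N: finite_mean_measure N by fact
  define q :: "nat \<Rightarrow> real" where "q n = of_rat (from_nat n)" for n
  have q_dense: "\<exists>i. a < q i \<and> q i < b" if ab: "a < b" for a b
  proof -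
    obtain r :: rat where "a < of_rat r" "of_rat r < b" using of_rat_dense[OF ab] by blast
    then show ?thesis by (intro exI[of _ "to_nat r"]) (simp add: q_def)
  qed
  obtain B where B [measurable]: "\<And>i. B i \<in> sets borel"
    and mass: "\<And>i. measure N (B i) = measure M {..q i}"
    and mean: "\<And>i. partial_mean N (B i) = partial_mean M {..q i}"
    and mono: "\<And>i j. q i \<le> q j \<Longrightarrow> measure N (B i - B j) = 0"
    using sublevel_family[OF assms, of q] by blast
  \<comment> \<open>On \<open>G\<close> the indices of the sets containing \<open>y\<close> form a
    nonempty set, upward closed in \<open>q\<close> and bounded below, so the infimum behaves
    well.\<close>
  define G where "G = {y. (\<exists>i. y \<in> B i) \<and> (\<exists>i. y \<notin> B i) \<and> (\<forall>i j. q i \<le> q j \<longrightarrow> y \<in> B i \<longrightarrow> y \<in> B j)}"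
  have [measurable]: "G \<in> sets borel" unfolding G_def by measurable
  have total: "measure N UNIV = measure M UNIV" using assms(4) by (simp add: cx_on_def)
  have "AE y in N. \<exists>i. y \<in> B i"
  proof -
    have "measure N (\<Inter>i. - B i) \<le> measure N UNIV - cdf M (real n)" for n
    proof -
      obtain i where i: "real n < q i" using q_dense[of "real n" "real n + 1"] by auto
      have "measure N (\<Inter>i. - B i) \<le> measure N (UNIV - B i)"
        by (intro N.finite_measure_mono) (auto simp: N.M_is_borel)
      also have "\<dots> = measure N UNIV - measure M {..q i}"
        by (subst N.finite_measure_Diff) (auto simp: N.M_is_borel mass)
      also have "\<dots> \<le> measure N UNIV - cdf M (real n)"
        using M.cdf_nondecreasing[of "real n" "q i"] i by (simp add: cdf_def2)
      finally show ?thesis .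
    qed
    moreover have "(\<lambda>n. measure N UNIV - cdf M (real n)) \<longlonglongrightarrow> measure N UNIV - measure M UNIV"
      using M.cdf_lim_infty by (intro tendsto_intros) simp
    ultimately have "measure N (\<Inter>i. - B i) \<le> 0"
      using total by (intro LIMSEQ_le_const[of _ 0]) auto
    then have "(\<Inter>i. - B i) \<in> null_sets N"
      by (auto simp: null_sets_def N.M_is_borel N.emeasure_eq_measure measure_le_0_iff)
    from AE_not_in[OF this] show ?thesis by simp
  qed
  moreover have "AE y in N. \<exists>i. y \<notin> B i"
  proof -
    have "measure N (\<Inter>i. B i) \<le> cdf M (- real n)" for n
    proof -
      obtain i where i: "q i < - real n" using q_dense[of "- real n - 1" "- real n"] by auto
      have "measure N (\<Inter>i. B i) \<le> measure N (B i)"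
        by (intro N.finite_measure_mono) (auto simp: N.M_is_borel)
      also have "\<dots> \<le> cdf M (- real n)"
        using M.cdf_nondecreasing[of "q i" "- real n"] i by (simp add: cdf_def2 mass)
      finally show ?thesis .
    qed
    then have "measure N (\<Inter>i. B i) \<le> 0"
      using M.cdf_lim_neg_infty by (intro LIMSEQ_le_const[of _ 0]) auto
    then have "(\<Inter>i. B i) \<in> null_sets N"
      by (auto simp: null_sets_def N.M_is_borel N.emeasure_eq_measure measure_le_0_iff)
    from AE_not_in[OF this] show ?thesis by simp
  qed
  moreover have "AE y in N. \<forall>i j. q i \<le> q j \<longrightarrow> y \<in> B i \<longrightarrow> y \<in> B j"
  proof -
    have "AE y in N. q i \<le> q j \<longrightarrow> y \<in> B i \<longrightarrow> y \<in> B j" for i j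
    proof (cases "q i \<le> q j")
      case True
      then have "B i - B j \<in> null_sets N"
        using mono[of i j] by (auto simp: null_sets_def N.M_is_borel N.emeasure_eq_measure)
      from AE_not_in[OF this] show ?thesis by (auto elim!: eventually_mono)
    qed simp
    then show ?thesis by (simp add: AE_all_countable)
  qed
  ultimately have AE_G: "AE y in N. y \<in> G" unfolding G_def by eventually_elim auto
  \<comment> \<open>The value 0 is a measurable default on the complement of \<open>G\<close>, a
    null set where the infimum may be that of an empty or unbounded set.\<close>
  define h where "h y = (if y \<in> G then Inf (q ` {i. y \<in> B i}) else 0)" for y
  have h_less: "h y < c \<longleftrightarrow> (\<exists>i. q i < c \<and> y \<in> B i)" if y: "y \<in> G" for y c
  proof -
    obtain j where j: "y \<notin> B j" using y by (auto simp: G_def)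
    have "bdd_below (q ` {i. y \<in> B i})"
    proof (rule bdd_belowI2[of _ "q j"])
      fix i assume "i \<in> {i. y \<in> B i}"
      then show "q j \<le> q i" using y j unfolding G_def by (cases "q i \<le> q j") auto
    qed
    moreover have "q ` {i. y \<in> B i} \<noteq> {}" using y by (auto simp: G_def)
    ultimately show ?thesis using y by (auto simp: h_def cInf_less_iff)
  qed
  have h_borel [measurable]: "h \<in> borel_measurable borel"
    unfolding borel_measurable_iff_less
  proof
    fix c
    have "h y < c \<longleftrightarrow> (if y \<in> G then \<exists>i. q i < c \<and> y \<in> B i else 0 < c)" for y
    proof (cases "y \<in> G")
      case True
      then show ?thesis by (simp add: h_less)
    next
      case False
      then show ?thesis by (simp add: h_def)
    qed
    then have "{y \<in> space borel. h y < c} = {y \<in> space borel. if y \<in> G then \<exists>i. q i < c \<and> y \<in> B i else 0 < c}"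
      by simp
    also have "\<dots> \<in> sets borel" by measurable
    finally show "{y \<in> space borel. h y < c} \<in> sets borel" .
  qed
  \<comment> \<open>Applied below with \<open>f\<close> constant 1 for the law of \<open>h\<close>
    and with \<open>f\<close> the identity for the barycentres.\<close>
  have sublevel: "(\<integral>y. indicator {y. h y \<le> c} y * f y \<partial>N) = (\<integral>x. indicator {..c} x * f x \<partial>M)"
    if intN: "integrable N f" and intM: "integrable M f"
      and eq: "\<And>i. (\<integral>y. indicator (B i) y * f y \<partial>N) = (\<integral>x. indicator {..q i} x * f x \<partial>M)"
    for f :: "real \<Rightarrow> real" and c
  proof -
    have [measurable]: "f \<in> borel_measurable borel" using intN by auto
    \<comment> \<open>The approach to \<open>c\<close> is strictly from above: membership in
      \<open>B i\<close> follows from \<open>h y < q i\<close>, but not from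
      \<open>h y = q i\<close>.\<close>
    have "\<exists>i. c < q i \<and> q i < c + inverse (real (Suc n))" for n by (rule q_dense) simp
    then obtain i where i: "\<And>n. c < q (i n)" "\<And>n. q (i n) < c + inverse (real (Suc n))" by metis
    have lim: "(\<lambda>n. q (i n)) \<longlonglongrightarrow> c"
    proof (rule real_tendsto_sandwich)
      show "\<forall>\<^sub>F n in sequentially. c \<le> q (i n)"
        using i(1) by (intro always_eventually allI less_imp_le)
      show "\<forall>\<^sub>F n in sequentially. q (i n) \<le> c + inverse (real (Suc n))"
        using i(2) by (intro always_eventually allI less_imp_le)
      show "(\<lambda>n. c) \<longlonglongrightarrow> c" by simp
      show "(\<lambda>n. c + inverse (real (Suc n))) \<longlonglongrightarrow> c"
        using LIMSEQ_inverse_real_of_nat_add by auto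
    qed
    have "(\<lambda>n. \<integral>y. indicator (B (i n)) y * f y \<partial>N) \<longlonglongrightarrow> (\<integral>y. indicator {y. h y \<le> c} y * f y \<partial>N)"
    proof (rule integral_dominated_convergence)
      show "integrable N (\<lambda>y. \<bar>f y\<bar>)" using intN by simp
      show "AE y in N. (\<lambda>n. indicator (B (i n)) y * f y) \<longlonglongrightarrow> indicator {y. h y \<le> c} y * f y"
        using AE_G
      proof eventually_elim
        case (elim y)
        have "\<forall>\<^sub>F n in sequentially. indicator (B (i n)) y = (indicator {y. h y \<le> c} y :: real)"
        proof (cases "h y \<le> c")
          case True
          have "y \<in> B (i n)" for n
          proof -
            have "h y < q (i n)" using True i(1)[of n] by simp
            then obtain j where "q j < q (i n)" "y \<in> B j" using h_less[OF elim] by auto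
            then show ?thesis using elim unfolding G_def by (auto dest: less_imp_le)
          qed
          then show ?thesis using True by simp
        next
          case False
          have "\<forall>\<^sub>F n in sequentially. q (i n) < h y" using order_tendstoD(2)[OF lim] False by simp
          then show ?thesis
          proof eventually_elim
            case (elim n)
            have "y \<notin> B (i n)"
            proof
              assume y: "y \<in> B (i n)"
              obtain c' where "q (i n) < c'" "c' < h y" using dense[OF elim] by blast
              then show False using h_less[OF \<open>y \<in> G\<close>, of c'] y by auto
            qed
            then show ?case using False by simp
          qed
        qed
        then show ?case by (intro tendsto_mult_right tendsto_eventually)
      qed
    qed (auto split: split_indicator)
    moreover have "(\<lambda>n. \<integral>x. indicator {..q (i n)} x * f x \<partial>M) \<longlonglongrightarrow> (\<integral>x. indicator {..c} x * f x \<partial>M)"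
    proof (rule integral_dominated_convergence)
      show "integrable M (\<lambda>y. \<bar>f y\<bar>)" using intM by simp
      show "AE x in M. (\<lambda>n. indicator {..q (i n)} x * f x) \<longlonglongrightarrow> indicator {..c} x * f x"
      proof (rule AE_I2)
        fix x
        have "\<forall>\<^sub>F n in sequentially. indicator {..q (i n)} x = (indicator {..c} x :: real)"
        proof (cases "x \<le> c")
          case True
          have "x \<le> q (i n)" for n using True i(1)[of n] by simp
          then show ?thesis using True by simp
        next
          case False
          have "\<forall>\<^sub>F n in sequentially. q (i n) < x" using order_tendstoD(2)[OF lim] False by simp
          then show ?thesis using False by (auto elim!: eventually_mono)
        qed
        then show "(\<lambda>n. indicator {..q (i n)} x * f x) \<longlonglongrightarrow> indicator {..c} x * f x"
          by (intro tendsto_mult_right tendsto_eventually)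
      qed
    qed (auto split: split_indicator)
    ultimately show ?thesis unfolding eq by (rule LIMSEQ_unique)
  qed
  have mass_h: "measure N {y. h y \<le> c} = measure M {..c}" for c
    using sublevel[of "\<lambda>_. 1" c] mass by (simp add: N.M_is_borel M.M_is_borel)
  have mean_h: "(\<integral>y. indicator {y. h y \<le> c} y * y \<partial>N) = (\<integral>x. indicator {..c} x * x \<partial>M)" for c
    using sublevel[of "\<lambda>y. y" c] mean N.integrable_id M.integrable_id by (simp add: partial_mean_def)
  have distr: "distr N borel h = M"
  proof (rule cdf_unique')
    show "finite_borel_measure (distr N borel h)"
      unfolding finite_borel_measure_def finite_borel_measure_axioms_def
      by (intro conjI N.finite_measure_distr) auto
    show "finite_borel_measure M" by unfold_locales
    show "cdf (distr N borel h) = cdf M"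
    proof
      fix c
      have "h -` {..c} = {y. h y \<le> c}" by auto
      then show "cdf (distr N borel h) c = cdf M c"
        by (simp add: cdf_def2 measure_distr mass_h)
    qed
  qed
  have int_h: "integrable N h"
    using M.integrable_id unfolding distr[symmetric] by (subst (asm) integrable_distr_eq) auto
  have int: "integrable N (\<lambda>y. y - h y)"
    by (intro Bochner_Integration.integrable_diff N.integrable_id int_h)
  \<comment> \<open>The integral of \<open>h\<close> is computed under its law \<open>M\<close>,
    that of \<open>y\<close> is given by \<open>mean_h\<close>.\<close>
  have zero: "(LINT y:h -` {..c}|N. y - h y) = 0" for c
  proof -
    have "(\<integral>y. indicator {y. h y \<le> c} y * h y \<partial>N) = (\<integral>x. indicator {..c} x * x \<partial>distr N borel h)"
      by (subst integral_distr) (auto intro!: Bochner_Integration.integral_cong split: split_indicator)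
    then have *: "(\<integral>y. indicator {y. h y \<le> c} y * h y \<partial>N) = (\<integral>y. indicator {y. h y \<le> c} y * y \<partial>N)"
      by (simp add: distr mean_h)
    have "h -` {..c} = {y. h y \<le> c}" by auto
    then have "(LINT y:h -` {..c}|N. y - h y) =
        (\<integral>y. indicator {y. h y \<le> c} y * y - indicator {y. h y \<le> c} y * h y \<partial>N)"
      by (simp add: set_lebesgue_integral_def right_diff_distrib)
    also have "\<dots> = 0"
      using int_h by (subst Bochner_Integration.integral_diff) (auto simp: * intro!: N.integrable_indicator_mult)
    finally show ?thesis .
  qed
  have mean_zero: "(\<integral>y. y - h y \<partial>N) = 0"
  proof -
    have "(\<integral>y. h y \<partial>N) = (\<integral>x. x \<partial>M)"
      unfolding distr[symmetric] by (subst integral_distr) auto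
    then show ?thesis
      using assms(4) int_h N.integrable_id by (simp add: cx_on_def partial_mean_def)
  qed
  have "(LINT y:h -` S|N. y - h y) = 0" if "S \<in> sets borel" for S
    using set_integral_preimage_eq_0[of h N "\<lambda>y. y - h y" S] int mean_zero zero that by simp
  moreover have "(LINT y:h -` S|N. y - h y) = (LINT y:h -` S|N. y) - (LINT y:h -` S|N. h y)"
    if "S \<in> sets borel" for S
  proof (rule set_integral_diff(2))
    have "h -` S \<in> sets N" using measurable_sets[OF h_borel that] by (simp add: N.M_is_borel)
    then show "set_integrable N (h -` S) (\<lambda>y. y)" "set_integrable N (h -` S) h"
      unfolding set_integrable_def
      by (intro integrable_mult_indicator N.integrable_id int_h; assumption)+
  qed
  ultimately show thesis
    by (intro that[OF h_borel distr]) simp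
qed

section \<open>Strict Jensen inequalities\<close>

lemma strictly_convex_imp_convex_on:
  assumes "strictly_convex f"
  shows "convex_on UNIV f"
proof (rule convex_onI)
  fix t x y :: real assume "0 < t" "t < 1"
  then show "f ((1 - t) *\<^sub>R x + t *\<^sub>R y) \<le> (1 - t) * f x + t * f y"
    using less_imp_le[OF assms[unfolded strictly_convex_def, rule_format, of x y t]]
    by (cases "x = y") (auto simp: algebra_simps)
qed simp

lemma strictly_convex_measurable:
  assumes "strictly_convex f"
  shows "f \<in> borel_measurable borel"
  using convex_on_continuous[OF open_UNIV strictly_convex_imp_convex_on[OF assms]]
  by (rule borel_measurable_continuous_onI)

text \<open>Contact of the supporting line at a second point is excluded at the midpoint, where
  \<open>f\<close> is above the line and strictly below the chord.\<close>

lemma strictly_convex_subgradient: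
  assumes "strictly_convex f"
  obtains c where "\<And>y. f x + c * (y - x) \<le> f y" "\<And>y. y \<noteq> x \<Longrightarrow> f x + c * (y - x) < f y"
proof -
  obtain c where c: "\<And>y. f x + c * (y - x) \<le> f y"
    using convex_le_Inf_differential[OF strictly_convex_imp_convex_on[OF assms], of x] by force
  moreover have "f x + c * (y - x) < f y" if "y \<noteq> x" for y
  proof -
    have "f ((1 - 1/2) * x + 1/2 * y) < (1 - 1/2) * f x + 1/2 * f y"
      using assms[unfolded strictly_convex_def, rule_format, of x y "1/2"] that by auto
    then have "f ((x + y) / 2) < (f x + f y) / 2" by (simp add: field_simps)
    moreover have "f x + c * (y - x) / 2 \<le> f ((x + y) / 2)"
      using c[of "(x + y) / 2"] by (simp add: field_simps)
    ultimately show ?thesis by (simp add: field_simps)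
  qed
  ultimately show thesis by (rule that)
qed

section \<open>Expectations in the extended reals\<close>

lemma ext_expectation_integrable:
  assumes "integrable M f"
  shows "ext_expectation M f = ereal (\<integral>x. f x \<partial>M)"
proof -
  from assms have "(\<integral>\<^sup>+ x. ennreal (f x) \<partial>M) \<noteq> \<infinity>" "(\<integral>\<^sup>+ x. ennreal (- f x) \<partial>M) \<noteq> \<infinity>"
    by (auto simp: real_integrable_def)
  then show ?thesis
    unfolding ext_expectation_def real_lebesgue_integral_def[OF assms]
    by (cases "\<integral>\<^sup>+ x. ennreal (f x) \<partial>M"; cases "\<integral>\<^sup>+ x. ennreal (- f x) \<partial>M")
      (auto simp: enn2ereal_ennreal)
qed

text \<open>The remainder \<open>f - k\<close> is nonnegative almost everywhere, so its integral
  makes sense even when \<open>f\<close> is not integrable; in that case both sides are infinite,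
  the negative part being controlled by \<open>k\<close>.\<close>

lemma ext_expectation_minorant:
  assumes k: "integrable M k" and f [measurable]: "f \<in> borel_measurable M" and le: "AE x in M. k x \<le> f x"
  shows "ext_expectation M f = ereal (\<integral>x. k x \<partial>M) + enn2ereal (\<integral>\<^sup>+ x. ennreal (f x - k x) \<partial>M)"
proof (cases "integrable M f")
  case True
  have "(\<integral>\<^sup>+ x. ennreal (f x - k x) \<partial>M) = ennreal (\<integral>x. f x - k x \<partial>M)"
    using k True le by (intro nn_integral_eq_integral) (auto elim!: eventually_mono)
  moreover have "0 \<le> (\<integral>x. f x - k x \<partial>M)"
    using le by (intro integral_nonneg_AE) (auto elim!: eventually_mono)
  ultimately show ?thesis
    using k True by (simp add: ext_expectation_integrable enn2ereal_ennreal)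
next
  case False
  have [measurable]: "k \<in> borel_measurable M" using k by auto
  have "(\<integral>\<^sup>+ x. ennreal (- f x) \<partial>M) \<le> (\<integral>\<^sup>+ x. ennreal (- k x) \<partial>M)"
    using le by (intro nn_integral_mono_AE) (auto elim!: eventually_mono intro: ennreal_leI)
  also have "\<dots> < \<infinity>" using k by (auto simp: real_integrable_def less_top)
  finally have neg: "(\<integral>\<^sup>+ x. ennreal (- f x) \<partial>M) < \<infinity>" .
  then have pos: "(\<integral>\<^sup>+ x. ennreal (f x) \<partial>M) = \<infinity>"
    using False by (auto simp: real_integrable_def)
  have "(\<integral>\<^sup>+ x. ennreal (f x - k x) \<partial>M) = \<infinity>"
  proof (rule ccontr)
    assume "(\<integral>\<^sup>+ x. ennreal (f x - k x) \<partial>M) \<noteq> \<infinity>"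
    then have "integrable M (\<lambda>x. f x - k x)"
      using le by (intro integrableI_nonneg) (auto elim!: eventually_mono simp: less_top)
    from Bochner_Integration.integrable_add[OF this k] show False using False by simp
  qed
  moreover have "ext_expectation M f = \<infinity>"
    unfolding ext_expectation_def pos using neg
    by (cases "\<integral>\<^sup>+ x. ennreal (- f x) \<partial>M") (auto simp: enn2ereal_ennreal)
  ultimately show ?thesis by simp
qed

text \<open>For the equality case, Jensen's inequality is applied to the midpoint \<open>Z\<close> of \<open>X\<close> and
  \<open>W = E[X|F]\<close>, which has the same conditional expectation; this avoids integrating
  (subgradient at \<open>W\<close>) times \<open>X - W\<close>, which need not be integrable.\<close>

context finite_measure_subalgebra
begin

lemma strict_jensen_cond_exp:
  assumes g: "strictly_convex g" and X: "integrable M X" and gX: "integrable M (\<lambda>x. g (X x))"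
  shows "integrable M (\<lambda>x. g (real_cond_exp M F X x))"
    and "(\<integral>x. g (real_cond_exp M F X x) \<partial>M) \<le> (\<integral>x. g (X x) \<partial>M)"
    and "(\<integral>x. g (real_cond_exp M F X x) \<partial>M) = (\<integral>x. g (X x) \<partial>M) \<Longrightarrow> AE x in M. real_cond_exp M F X x = X x"
proof -
  have cvx: "convex_on UNIV g" and [measurable]: "g \<in> borel_measurable borel"
    using g by (simp_all add: strictly_convex_imp_convex_on strictly_convex_measurable)
  have [measurable]: "X \<in> borel_measurable M" using X by auto
  have int: "integrable M (\<lambda>x. g (real_cond_exp M F Z x))"
    and jensen: "(\<integral>x. g (real_cond_exp M F Z x) \<partial>M) \<le> (\<integral>x. g (Z x) \<partial>M)"
    if Z: "integrable M Z" and gZ: "integrable M (\<lambda>x. g (Z x))" for Z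
  proof -
    show int: "integrable M (\<lambda>x. g (real_cond_exp M F Z x))"
      using Z gZ cvx finite_emeasure_space
      by (intro integrable_convex_cond_exp[where I = UNIV]) auto
    have "(\<integral>x. g (real_cond_exp M F Z x) \<partial>M) \<le> (\<integral>x. real_cond_exp M F (\<lambda>x. g (Z x)) x \<partial>M)"
      using real_cond_exp_jensens_inequality(2)[OF Z _ _ gZ cvx] real_cond_exp_int(1)[OF gZ]
      by (intro integral_mono_AE int) auto
    then show "(\<integral>x. g (real_cond_exp M F Z x) \<partial>M) \<le> (\<integral>x. g (Z x) \<partial>M)"
      by (simp add: real_cond_exp_int(2)[OF gZ])
  qed
  define W where "W = real_cond_exp M F X"
  have [measurable]: "W \<in> borel_measurable M" by (simp add: W_def)
  have W: "integrable M W" unfolding W_def by (rule real_cond_exp_int(1)[OF X])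
  have gW: "integrable M (\<lambda>x. g (W x))" unfolding W_def by (rule int[OF X gX])
  show "integrable M (\<lambda>x. g (real_cond_exp M F X x))" by (rule int[OF X gX])
  show "(\<integral>x. g (real_cond_exp M F X x) \<partial>M) \<le> (\<integral>x. g (X x) \<partial>M)" by (rule jensen[OF X gX])
  assume eq: "(\<integral>x. g (real_cond_exp M F X x) \<partial>M) = (\<integral>x. g (X x) \<partial>M)"
  define Z where "Z x = (X x + W x) / 2" for x
  have Z: "integrable M Z" unfolding Z_def using X W by simp
  have mid: "g (Z x) \<le> (g (X x) + g (W x)) / 2" "X x \<noteq> W x \<Longrightarrow> g (Z x) < (g (X x) + g (W x)) / 2" for x
  proof -
    show "g (Z x) < (g (X x) + g (W x)) / 2" if "X x \<noteq> W x"
      using g[unfolded strictly_convex_def, rule_format, of "X x" "W x" "1/2"] that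
      by (simp add: Z_def field_simps)
    then show "g (Z x) \<le> (g (X x) + g (W x)) / 2" by (cases "X x = W x") (auto simp: Z_def)
  qed
  obtain c where c: "\<And>y. g 0 + c * (y - 0) \<le> g y" using strictly_convex_subgradient[OF g] by metis
  \<comment> \<open>Convexity bounds \<open>g (Z x)\<close> from above, and a supporting line at 0
    bounds it from below.\<close>
  have gZ: "integrable M (\<lambda>x. g (Z x))"
  proof (rule Bochner_Integration.integrable_bound)
    show "integrable M (\<lambda>x. \<bar>g (X x)\<bar> + \<bar>g (W x)\<bar> + (\<bar>g 0\<bar> + \<bar>c * Z x\<bar>))"
      using gX gW Z by simp
    show "(\<lambda>x. g (Z x)) \<in> borel_measurable M" unfolding Z_def by measurable
    show "AE x in M. norm (g (Z x)) \<le> norm (\<bar>g (X x)\<bar> + \<bar>g (W x)\<bar> + (\<bar>g 0\<bar> + \<bar>c * Z x\<bar>))"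
    proof (rule AE_I2)
      fix x
      have "\<bar>g (Z x)\<bar> \<le> \<bar>g (X x)\<bar> + \<bar>g (W x)\<bar> + (\<bar>g 0\<bar> + \<bar>c * Z x\<bar>)"
        using mid(1)[of x] c[of "Z x"] by (intro abs_leI) (simp_all add: abs_if)
      then show "norm (g (Z x)) \<le> norm (\<bar>g (X x)\<bar> + \<bar>g (W x)\<bar> + (\<bar>g 0\<bar> + \<bar>c * Z x\<bar>))"
        by simp
    qed
  qed
  have "AE x in M. real_cond_exp M F Z x = W x"
  proof -
    have "AE x in M. real_cond_exp M F (\<lambda>x. X x + W x) x = real_cond_exp M F X x + real_cond_exp M F W x"
      by (rule real_cond_exp_add[OF X W])
    moreover have "AE x in M. real_cond_exp M F W x = W x"
      by (rule real_cond_exp_F_meas[OF W]) (simp add: W_def)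
    moreover have "AE x in M. real_cond_exp M F (\<lambda>x. (X x + W x) / 2) x = real_cond_exp M F (\<lambda>x. X x + W x) x / 2"
      using X W by (intro real_cond_exp_cdiv) simp
    ultimately show ?thesis unfolding Z_def[abs_def] by eventually_elim (simp add: W_def)
  qed
  then have "(\<integral>x. g (real_cond_exp M F Z x) \<partial>M) = (\<integral>x. g (W x) \<partial>M)"
    by (intro integral_cong_AE) auto
  \<comment> \<open>With \<open>eq\<close> this closes the chain: the integral of
    \<open>g (Z x)\<close> lies between that of \<open>g (W x)\<close> and the average of two equal
    integrals. The nonnegative midpoint gap therefore has integral zero.\<close>
  then have "(\<integral>x. g (W x) \<partial>M) \<le> (\<integral>x. g (Z x) \<partial>M)" using jensen[OF Z gZ] by simp
  moreover have "(\<integral>x. (g (X x) + g (W x)) / 2 - g (Z x) \<partial>M)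
      = ((\<integral>x. g (X x) \<partial>M) + (\<integral>x. g (W x) \<partial>M)) / 2 - (\<integral>x. g (Z x) \<partial>M)"
    using gX gW gZ by simp
  moreover have "0 \<le> (\<integral>x. (g (X x) + g (W x)) / 2 - g (Z x) \<partial>M)"
    using mid(1) by (intro Bochner_Integration.integral_nonneg) simp
  ultimately have "(\<integral>x. (g (X x) + g (W x)) / 2 - g (Z x) \<partial>M) = 0"
    using eq by (simp add: W_def)
  then have "AE x in M. (g (X x) + g (W x)) / 2 - g (Z x) = 0"
    using gX gW gZ mid(1) by (subst (asm) integral_nonneg_eq_0_iff_AE) auto
  then show "AE x in M. real_cond_exp M F X x = X x"
    unfolding W_def[symmetric]
  proof eventually_elim
    case (elim x)
    then show ?case using mid(2)[of x] by (cases "X x = W x") auto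
  qed
qed

end

section \<open>Convex order, couplings and conditional expectations\<close>

lemma (in prob_space) finite_measure_subalgebra_vimage:
  fixes X :: "'a \<Rightarrow> real"
  assumes "X \<in> borel_measurable M"
  shows "finite_measure_subalgebra M (vimage_algebra (space M) X borel)"
proof
  show "subalgebra M (vimage_algebra (space M) X borel)"
    unfolding subalgebra_def
    using measurable_sets[OF assms] by (auto simp: sets_vimage_algebra2)
qed

text \<open>The test functions \<open>x\<close> and \<open>- x\<close> give equality of means, and
  the calls give the rest. All are integrable, so the extended expectations are ordinary
  integrals.\<close>

lemma convex_order_imp_cx_on:
  assumes "\<mu> \<in> prob_finite_mean" "\<nu> \<in> prob_finite_mean" "\<mu> \<le>cx \<nu>"
  shows "finite_mean_measure \<mu>" "finite_mean_measure \<nu>" "cx_on \<mu> UNIV \<nu> UNIV"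
proof -
  have fm: "finite_mean_measure M" "prob_space M" if "M \<in> prob_finite_mean" for M
    using that unfolding prob_finite_mean_def finite_mean_measure_def finite_mean_measure_axioms_def
      finite_borel_measure_def finite_borel_measure_axioms_def
    by (auto simp: prob_space.axioms)
  show "finite_mean_measure \<mu>" "finite_mean_measure \<nu>" using fm assms by auto
  then interpret mu: finite_mean_measure \<mu> + nu: finite_mean_measure \<nu> by auto
  have le: "(\<integral>x. \<phi> x \<partial>\<mu>) \<le> (\<integral>x. \<phi> x \<partial>\<nu>)"
    if "convex_on UNIV \<phi>" "integrable \<mu> \<phi>" "integrable \<nu> \<phi>" for \<phi>
  proof -
    have "ext_expectation \<mu> \<phi> \<le> ext_expectation \<nu> \<phi>" using assms(3) that(1) by (simp add: convex_order_def)
    then show ?thesis by (simp add: ext_expectation_integrable[OF that(2)] ext_expectation_integrable[OF that(3)])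
  qed
  have "measure \<mu> UNIV = measure \<nu> UNIV"
    using prob_space.prob_space[OF fm(2)] assms by (metis mu.space_M nu.space_M)
  moreover have "(\<integral>x. x \<partial>\<mu>) = (\<integral>x. x \<partial>\<nu>)"
  proof (rule antisym)
    show "(\<integral>x. x \<partial>\<mu>) \<le> (\<integral>x. x \<partial>\<nu>)"
      by (intro le mu.integrable_id nu.integrable_id) (auto intro: convex_onI)
    have "(\<integral>x. - x \<partial>\<mu>) \<le> (\<integral>x. - x \<partial>\<nu>)"
      by (intro le Bochner_Integration.integrable_minus mu.integrable_id nu.integrable_id)
        (auto intro!: convex_onI simp: algebra_simps)
    then show "(\<integral>x. x \<partial>\<nu>) \<le> (\<integral>x. x \<partial>\<mu>)" by simp
  qed
  moreover have "(\<integral>x. max 0 (x - k) \<partial>\<mu>) \<le> (\<integral>x. max 0 (x - k) \<partial>\<nu>)" for k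
  proof (intro le mu.integrable_call nu.integrable_call convex_onI)
    fix t x y :: real assume t: "0 < t" "t < 1"
    have "(1 - t) * (x - k) + t * (y - k) \<le> (1 - t) * max 0 (x - k) + t * max 0 (y - k)"
      using t by (intro add_mono mult_left_mono) auto
    moreover have "0 \<le> (1 - t) * max 0 (x - k) + t * max 0 (y - k)" using t by simp
    moreover have "(1 - t) *\<^sub>R x + t *\<^sub>R y - k = (1 - t) * (x - k) + t * (y - k)"
      by (simp add: algebra_simps)
    ultimately show "max 0 ((1 - t) *\<^sub>R x + t *\<^sub>R y - k) \<le> (1 - t) * max 0 (x - k) + t * max 0 (y - k)"
      by simp
  qed simp
  ultimately show "cx_on \<mu> UNIV \<nu> UNIV"
    by (simp add: cx_on_def partial_mean_def call_def)
qed

lemma space_coupling: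
  assumes "\<pi> \<in> couplings \<mu> \<nu>"
  shows "space \<pi> = UNIV"
  using assms sets_eq_imp_space_eq[of \<pi> "borel \<Otimes>\<^sub>M borel"]
  by (auto simp: couplings_def space_pair_measure)

lemma coupling_measurable:
  assumes "\<pi> \<in> couplings \<mu> \<nu>"
  shows "fst \<in> borel_measurable \<pi>" "snd \<in> borel_measurable \<pi>"
proof -
  have sets: "sets \<pi> = sets (borel \<Otimes>\<^sub>M borel)" using assms by (simp add: couplings_def)
  show "fst \<in> borel_measurable \<pi>" "snd \<in> borel_measurable \<pi>"
    unfolding measurable_cong_sets[OF sets refl] by measurable
qed

lemma coupling_integrable:
  fixes f :: "real \<Rightarrow> real"
  assumes \<pi>: "\<pi> \<in> couplings \<mu> \<nu>"
  shows "integrable \<mu> f \<Longrightarrow> integrable \<pi> (\<lambda>\<omega>. f (fst \<omega>))"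
    and "integrable \<nu> f \<Longrightarrow> integrable \<pi> (\<lambda>\<omega>. f (snd \<omega>))"
    and "f \<in> borel_measurable borel \<Longrightarrow> (\<integral>\<omega>. f (fst \<omega>) \<partial>\<pi>) = (\<integral>x. f x \<partial>\<mu>)"
    and "f \<in> borel_measurable borel \<Longrightarrow> (\<integral>\<omega>. f (snd \<omega>) \<partial>\<pi>) = (\<integral>x. f x \<partial>\<nu>)"
proof -
  have eq: "distr \<pi> borel fst = \<mu>" "distr \<pi> borel snd = \<nu>" using \<pi> by (auto simp: couplings_def)
  note meas = coupling_measurable[OF \<pi>]
  show "integrable \<mu> f \<Longrightarrow> integrable \<pi> (\<lambda>\<omega>. f (fst \<omega>))"
    unfolding eq(1)[symmetric] using meas(1) by (rule integrable_distr)
  show "integrable \<nu> f \<Longrightarrow> integrable \<pi> (\<lambda>\<omega>. f (snd \<omega>))"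
    unfolding eq(2)[symmetric] using meas(2) by (rule integrable_distr)
  show "f \<in> borel_measurable borel \<Longrightarrow> (\<integral>\<omega>. f (fst \<omega>) \<partial>\<pi>) = (\<integral>x. f x \<partial>\<mu>)"
    unfolding eq(1)[symmetric] using meas(1) by (simp add: integral_distr)
  show "f \<in> borel_measurable borel \<Longrightarrow> (\<integral>\<omega>. f (snd \<omega>) \<partial>\<pi>) = (\<integral>x. f x \<partial>\<nu>)"
    unfolding eq(2)[symmetric] using meas(2) by (simp add: integral_distr)
qed

text \<open>A function of \<open>Y\<close> is fixed by conditioning on \<open>Y\<close>; conversely
  \<open>E[X|Y]\<close> factors through \<open>Y\<close> (Doob-Dynkin). This links the Monge
  condition to the equality case of Jensen's inequality for \<open>g\<close>.\<close>

lemma monge_map_iff_cond_expectation: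
  assumes \<pi>: "\<pi> \<in> couplings \<mu> \<nu>" and \<mu>: "integrable \<mu> (\<lambda>x. x)"
  shows "(\<exists>h \<in> borel_measurable borel. AE \<omega> in \<pi>. fst \<omega> = h (snd \<omega>)) \<longleftrightarrow>
    (AE \<omega> in \<pi>. cond_expectation \<pi> fst snd \<omega> = fst \<omega>)"
proof -
  interpret prob_space \<pi> using \<pi> by (simp add: couplings_def)
  note meas [measurable] = coupling_measurable[OF \<pi>] and space = space_coupling[OF \<pi>]
  let ?F = "vimage_algebra (space \<pi>) snd borel"
  interpret F: finite_measure_subalgebra \<pi> ?F
    by (rule finite_measure_subalgebra_vimage) simp
  have int: "integrable \<pi> fst" using coupling_integrable(1)[OF \<pi> \<mu>] by simp
  show ?thesis
  proof
    assume "\<exists>h \<in> borel_measurable borel. AE \<omega> in \<pi>. fst \<omega> = h (snd \<omega>)"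
    then obtain h where h [measurable]: "h \<in> borel_measurable borel" and ae: "AE \<omega> in \<pi>. fst \<omega> = h (snd \<omega>)"
      by blast
    have "AE \<omega> in \<pi>. real_cond_exp \<pi> ?F fst \<omega> = real_cond_exp \<pi> ?F (\<lambda>\<omega>. h (snd \<omega>)) \<omega>"
      using ae by (rule F.real_cond_exp_cong) auto
    moreover have "AE \<omega> in \<pi>. real_cond_exp \<pi> ?F (\<lambda>\<omega>. h (snd \<omega>)) \<omega> = h (snd \<omega>)"
    proof (rule F.real_cond_exp_F_meas)
      show "integrable \<pi> (\<lambda>\<omega>. h (snd \<omega>))"
        using int ae by (subst integrable_cong_AE[of _ _ fst]) auto
      show "(\<lambda>\<omega>. h (snd \<omega>)) \<in> borel_measurable ?F"
        by (rule measurable_compose[OF measurable_vimage_algebra1 h]) auto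
    qed
    ultimately show "AE \<omega> in \<pi>. cond_expectation \<pi> fst snd \<omega> = fst \<omega>"
      unfolding cond_expectation_def using ae by eventually_elim simp
  next
    assume ae: "AE \<omega> in \<pi>. cond_expectation \<pi> fst snd \<omega> = fst \<omega>"
    define W where "W = cond_expectation \<pi> fst snd"
    have WF: "W \<in> borel_measurable ?F" by (simp add: W_def cond_expectation_def)
    then have W: "W \<in> borel_measurable \<pi>" by (rule measurable_from_subalg[OF F.subalg])
    \<comment> \<open>\<open>W\<close> is constant on the fibres of \<open>snd\<close>, so any section of \<open>snd\<close> gives the map \<open>h\<close>.\<close>
    have "W \<omega> = W (0, snd \<omega>)" for \<omega>
    proof -
      have "W -` {W \<omega>} \<inter> space ?F \<in> sets ?F" using WF by (rule measurable_sets) simp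
      then obtain A where "W -` {W \<omega>} = snd -` A" by (auto simp: sets_vimage_algebra2 space)
      then have "\<omega>' \<in> W -` {W \<omega>} \<longleftrightarrow> snd \<omega>' \<in> A" for \<omega>' by simp
      from this[of \<omega>] this[of "(0, snd \<omega>)"] show ?thesis by simp
    qed
    moreover have "(\<lambda>y. W (0, y)) \<in> borel_measurable borel"
    proof (rule measurable_compose[OF _ W])
      have sets: "sets \<pi> = sets (borel \<Otimes>\<^sub>M borel)" using \<pi> by (simp add: couplings_def)
      show "(\<lambda>y. (0, y)) \<in> borel \<rightarrow>\<^sub>M \<pi>"
        unfolding measurable_cong_sets[OF refl sets] by measurable
    qed
    ultimately show "\<exists>h \<in> borel_measurable borel. AE \<omega> in \<pi>. fst \<omega> = h (snd \<omega>)"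
      using ae unfolding W_def[symmetric]
      by (intro bexI[of _ "\<lambda>y. W (0, y)"]) (auto elim!: eventually_mono)
  qed
qed

text \<open>The transport is the law of \<open>(h y, y)\<close> under \<open>\<nu>\<close>. Events
  generated by \<open>fst\<close> pull back to preimages under \<open>h\<close>, where the integral
  identity of \<open>monge_map_exists\<close> is the defining property of conditional
  expectation.\<close>

lemma monge_martingale_transports_nonempty:
  assumes \<mu>: "\<mu> \<in> prob_finite_mean" and \<nu>: "\<nu> \<in> prob_finite_mean"
    and cx: "\<mu> \<le>cx \<nu>" and at: "atomless \<nu>"
  shows "monge_martingale_transports \<mu> \<nu> \<noteq> {}"
proof -
  note fm = convex_order_imp_cx_on[OF \<mu> \<nu> cx]
  obtain h where h [measurable]: "h \<in> borel_measurable borel" and distr: "distr \<nu> borel h = \<mu>"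
    and mart: "\<And>S. S \<in> sets borel \<Longrightarrow> (LINT y:h -` S|\<nu>. y) = (LINT y:h -` S|\<nu>. h y)"
    using monge_map_exists[OF fm(1,2) at fm(3)] by blast
  interpret nu: finite_mean_measure \<nu> by (rule fm)
  interpret nu: prob_space \<nu> using \<nu> by (simp add: prob_finite_mean_def)
  define \<pi> where "\<pi> = distr \<nu> (borel \<Otimes>\<^sub>M borel) (\<lambda>y. (h y, y))"
  have graph: "(\<lambda>y. (h y, y)) \<in> \<nu> \<rightarrow>\<^sub>M borel \<Otimes>\<^sub>M borel"
    unfolding measurable_cong_sets[OF nu.M_is_borel refl] by measurable
  have \<pi>: "\<pi> \<in> couplings \<mu> \<nu>"
  proof -
    have "distr \<pi> borel fst = \<mu>"
      unfolding \<pi>_def by (subst distr_distr[OF _ graph]) (auto simp: comp_def distr)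
    moreover have "distr \<pi> borel snd = \<nu>"
    proof -
      have "distr \<pi> borel snd = distr \<nu> borel (\<lambda>y. y)"
        unfolding \<pi>_def by (subst distr_distr[OF _ graph]) (auto simp: comp_def)
      also have "\<dots> = distr \<nu> \<nu> (\<lambda>y. y)" by (rule distr_cong) (simp_all add: nu.M_is_borel)
      finally show ?thesis by (simp add: distr_id)
    qed
    moreover have "prob_space \<pi>" unfolding \<pi>_def by (rule nu.prob_space_distr[OF graph])
    ultimately show ?thesis by (simp add: couplings_def) (simp add: \<pi>_def)
  qed
  interpret prob_space \<pi> using \<pi> by (simp add: couplings_def)
  note meas [measurable] = coupling_measurable[OF \<pi>] and space = space_coupling[OF \<pi>]
  let ?F = "vimage_algebra (space \<pi>) fst borel"
  interpret F: finite_measure_subalgebra \<pi> ?F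
    by (rule finite_measure_subalgebra_vimage) simp
  have "AE \<omega> in \<pi>. real_cond_exp \<pi> ?F snd \<omega> = fst \<omega>"
  proof (rule F.real_cond_exp_charact)
    show "integrable \<pi> snd" "integrable \<pi> fst"
      using coupling_integrable(1,2)[OF \<pi>, of "\<lambda>x. x"] \<mu> \<nu> by (auto simp: prob_finite_mean_def)
    show "fst \<in> borel_measurable ?F" by (rule measurable_vimage_algebra1) simp
    fix A assume "A \<in> sets ?F"
    then obtain S where S [measurable]: "S \<in> sets borel" and A: "A = fst -` S"
      by (auto simp: sets_vimage_algebra2 space)
    have [measurable]: "fst -` S \<in> sets (borel \<Otimes>\<^sub>M (borel :: real measure))"
      using measurable_sets[OF measurable_fst S, of "borel :: real measure"] by (simp add: space_pair_measure)
    have eq: "(LINT \<omega>:A|\<pi>. f \<omega>) = (LINT y:h -` S|\<nu>. f (h y, y))"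
      if [measurable]: "f \<in> borel_measurable (borel \<Otimes>\<^sub>M borel)" for f :: "real \<times> real \<Rightarrow> real"
      unfolding \<pi>_def set_lebesgue_integral_def A
      by (subst integral_distr[OF graph]) (auto intro!: Bochner_Integration.integral_cong split: split_indicator)
    show "(LINT \<omega>:A|\<pi>. snd \<omega>) = (LINT \<omega>:A|\<pi>. fst \<omega>)"
      by (simp add: eq mart[OF S])
  qed
  moreover have "AE \<omega> in \<pi>. fst \<omega> = h (snd \<omega>)"
    unfolding \<pi>_def by (subst AE_distr_iff[OF graph]) auto
  ultimately have "\<pi> \<in> monge_martingale_transports \<mu> \<nu>"
    using \<pi> h by (auto simp: monge_martingale_transports_def cond_expectation_def)
  then show ?thesis by blast
qed

section \<open>The objective and its minimisers\<close>

lemma transport_objective_bound: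
  assumes \<mu>: "\<mu> \<in> prob_finite_mean" and \<nu>: "\<nu> \<in> prob_finite_mean" and cx: "\<mu> \<le>cx \<nu>"
    and f: "strictly_convex f" and g: "strictly_convex g" and g\<mu>: "integrable \<mu> g"
    and \<pi>: "\<pi> \<in> couplings \<mu> \<nu>"
  shows "ereal (f 0 - (\<integral>x. g x \<partial>\<mu>)) \<le> transport_objective f g \<pi>"
    and "transport_objective f g \<pi> = ereal (f 0 - (\<integral>x. g x \<partial>\<mu>)) \<longleftrightarrow> \<pi> \<in> monge_martingale_transports \<mu> \<nu>"
proof -
  interpret prob_space \<pi> using \<pi> by (simp add: couplings_def)
  note meas [measurable] = coupling_measurable[OF \<pi>]
  have [measurable]: "f \<in> borel_measurable borel" "g \<in> borel_measurable borel"
    using f g by (simp_all add: strictly_convex_measurable)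
  interpret X: finite_measure_subalgebra \<pi> "vimage_algebra (space \<pi>) fst borel"
    by (rule finite_measure_subalgebra_vimage) simp
  interpret Y: finite_measure_subalgebra \<pi> "vimage_algebra (space \<pi>) snd borel"
    by (rule finite_measure_subalgebra_vimage) simp
  have int\<mu>: "integrable \<mu> (\<lambda>x. x)" and int: "integrable \<pi> fst" "integrable \<pi> snd"
    using coupling_integrable(1,2)[OF \<pi>, of "\<lambda>x. x"] \<mu> \<nu> by (auto simp: prob_finite_mean_def)
  have intg: "integrable \<pi> (\<lambda>\<omega>. g (fst \<omega>))" by (rule coupling_integrable(1)[OF \<pi> g\<mu>])
  define V where "V \<omega> = cond_expectation \<pi> snd fst \<omega> - fst \<omega>" for \<omega>
  define W where "W = cond_expectation \<pi> fst snd"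
  have V: "integrable \<pi> V"
    unfolding V_def cond_expectation_def
    using X.real_cond_exp_int(1)[OF int(2)] int(1) by (rule Bochner_Integration.integrable_diff)
  have V0: "(\<integral>\<omega>. V \<omega> \<partial>\<pi>) = 0"
  proof -
    have "(\<integral>\<omega>. V \<omega> \<partial>\<pi>) = (\<integral>\<omega>. snd \<omega> \<partial>\<pi>) - (\<integral>\<omega>. fst \<omega> \<partial>\<pi>)"
      unfolding V_def cond_expectation_def
      using X.real_cond_exp_int[OF int(2)] int(1) by (simp add: Bochner_Integration.integral_diff)
    also have "\<dots> = 0"
      using coupling_integrable(3,4)[OF \<pi>, of "\<lambda>x. x"] convex_order_imp_cx_on(3)[OF \<mu> \<nu> cx]
      by (simp add: cx_on_def partial_mean_def)
    finally show ?thesis .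
  qed
  have gW: "integrable \<pi> (\<lambda>\<omega>. g (W \<omega>))"
    and gW_le: "(\<integral>\<omega>. g (W \<omega>) \<partial>\<pi>) \<le> (\<integral>x. g x \<partial>\<mu>)"
    and gW_eq: "(\<integral>\<omega>. g (W \<omega>) \<partial>\<pi>) = (\<integral>x. g x \<partial>\<mu>) \<Longrightarrow> AE \<omega> in \<pi>. W \<omega> = fst \<omega>"
    using Y.strict_jensen_cond_exp[OF g int(1) intg] coupling_integrable(3)[OF \<pi>, of g]
    by (simp_all add: W_def cond_expectation_def)
  have [measurable]: "V \<in> borel_measurable \<pi>" "W \<in> borel_measurable \<pi>"
    using V by (auto simp: W_def cond_expectation_def)
  obtain c where c: "\<And>y. f 0 + c * (y - 0) \<le> f y" "\<And>y. y \<noteq> 0 \<Longrightarrow> f 0 + c * (y - 0) < f y"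
    using strictly_convex_subgradient[OF f] by metis
  \<comment> \<open>\<open>D\<close> is the expected gap between \<open>f\<close> and its supporting
    line at 0, possibly infinite. The linear term disappears from the objective because
    \<open>V\<close> has mean zero.\<close>
  define D where "D = (\<integral>\<^sup>+ \<omega>. ennreal (f (V \<omega>) - f 0 - c * V \<omega>) \<partial>\<pi>)"
  have obj: "transport_objective f g \<pi> = ereal (f 0 - (\<integral>\<omega>. g (W \<omega>) \<partial>\<pi>)) + enn2ereal D"
  proof -
    have k: "integrable \<pi> (\<lambda>\<omega>. f 0 + c * V \<omega> - g (W \<omega>))" using V gW by simp
    have "transport_objective f g \<pi> = ext_expectation \<pi> (\<lambda>\<omega>. f (V \<omega>) - g (W \<omega>))"
      by (simp add: transport_objective_def V_def W_def)
    also have "\<dots> = ereal (\<integral>\<omega>. f 0 + c * V \<omega> - g (W \<omega>) \<partial>\<pi>)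
        + enn2ereal (\<integral>\<^sup>+ \<omega>. ennreal (f (V \<omega>) - g (W \<omega>) - (f 0 + c * V \<omega> - g (W \<omega>))) \<partial>\<pi>)"
      using c(1) by (intro ext_expectation_minorant k AE_I2) auto
    also have "(\<integral>\<omega>. f 0 + c * V \<omega> - g (W \<omega>) \<partial>\<pi>) = f 0 - (\<integral>\<omega>. g (W \<omega>) \<partial>\<pi>)"
      using V gW V0 by (simp add: prob_space)
    finally show ?thesis by (simp add: D_def algebra_simps)
  qed
  have D: "D = 0 \<longleftrightarrow> (AE \<omega> in \<pi>. V \<omega> = 0)"
  proof -
    have "f y - f 0 - c * y \<le> 0 \<longleftrightarrow> y = 0" for y
      using c(2)[of y] by (cases "y = 0") auto
    then show ?thesis unfolding D_def by (subst nn_integral_0_iff_AE) (auto simp: ennreal_eq_0_iff)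
  qed
  have D_nonneg: "0 \<le> enn2ereal D" by (rule enn2ereal_nonneg)
  show "ereal (f 0 - (\<integral>x. g x \<partial>\<mu>)) \<le> transport_objective f g \<pi>"
    unfolding obj using gW_le D_nonneg by (cases "enn2ereal D") auto
  have "transport_objective f g \<pi> = ereal (f 0 - (\<integral>x. g x \<partial>\<mu>)) \<longleftrightarrow>
      (\<integral>\<omega>. g (W \<omega>) \<partial>\<pi>) = (\<integral>x. g x \<partial>\<mu>) \<and> enn2ereal D = 0"
    unfolding obj using gW_le D_nonneg by (cases "enn2ereal D") auto
  also have "\<dots> \<longleftrightarrow> (AE \<omega> in \<pi>. W \<omega> = fst \<omega>) \<and> (AE \<omega> in \<pi>. V \<omega> = 0)"
  proof -
    have "(\<integral>\<omega>. g (W \<omega>) \<partial>\<pi>) = (\<integral>x. g x \<partial>\<mu>)" if "AE \<omega> in \<pi>. W \<omega> = fst \<omega>"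
    proof -
      have "(\<integral>\<omega>. g (W \<omega>) \<partial>\<pi>) = (\<integral>\<omega>. g (fst \<omega>) \<partial>\<pi>)"
        using that by (intro integral_cong_AE) (auto elim!: eventually_mono)
      then show ?thesis using coupling_integrable(3)[OF \<pi>, of g] by simp
    qed
    moreover have "enn2ereal D = 0 \<longleftrightarrow> D = 0"
      by (metis enn2ereal_inject zero_ennreal.rep_eq)
    ultimately show ?thesis using gW_eq D by blast
  qed
  also have "\<dots> \<longleftrightarrow> \<pi> \<in> monge_martingale_transports \<mu> \<nu>"
    using monge_map_iff_cond_expectation[OF \<pi> int\<mu>] \<pi>
    by (auto simp: monge_martingale_transports_def V_def W_def)
  finally show "transport_objective f g \<pi> = ereal (f 0 - (\<integral>x. g x \<partial>\<mu>)) \<longleftrightarrow>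
      \<pi> \<in> monge_martingale_transports \<mu> \<nu>" .
qed

theorem proposition3p8:
  fixes \<mu> \<nu> :: "real measure" and f g :: "real \<Rightarrow> real"
  assumes "\<mu> \<in> prob_finite_mean" and "\<nu> \<in> prob_finite_mean"
    and "\<mu> \<le>cx \<nu>" and "atomless \<nu>"
    and "strictly_convex f" and "strictly_convex g"
    and "integrable \<mu> g"
  shows "monge_martingale_transports \<mu> \<nu>
    = arg_min_set (transport_objective f g) (couplings \<mu> \<nu>)"
proof -
  note bound = transport_objective_bound[OF assms(1-3,5-7)]
  have sub: "monge_martingale_transports \<mu> \<nu> \<subseteq> couplings \<mu> \<nu>"
    by (auto simp: monge_martingale_transports_def)
  \<comment> \<open>An existing transport attains the lower bound, so the minimisers are exactly the
    couplings for which the bound is an equality.\<close>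
  obtain \<pi>0 where \<pi>0: "\<pi>0 \<in> monge_martingale_transports \<mu> \<nu>"
    using monge_martingale_transports_nonempty[OF assms(1-4)] by blast
  have "\<pi> \<in> monge_martingale_transports \<mu> \<nu> \<longleftrightarrow>
      is_arg_min (transport_objective f g) (\<lambda>\<pi>. \<pi> \<in> couplings \<mu> \<nu>) \<pi>" for \<pi>
    using bound sub \<pi>0 unfolding is_arg_min_def by (metis order.strict_iff_order not_le subsetD)
  then show ?thesis by (auto simp: arg_min_set_def)
qed

end
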